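(* Let $\mathcal{N}:\mathcal{L}(A)\to\mathcal{L}(B)$ be a quantum channel whose complementary channel $\mathcal{N}^c:\mathcal{L}(A)\to\mathcal{L}(E)$ is a cq-channel, i.e. there are an orthonormal (computational) basis $\{|i\rangle\}$ of $A$ and states $\rho_i$ on $E$ with $\mathcal{N}^c(|i\rangle\langle i'|)=\delta_{ii'}\rho_i$. Then the weak locking capacity of $\mathcal{N}$ satisfies $$L_W(\mathcal{N})\ \le\ \max_{(p_i)}S_{\mathrm{acc}}(I|E),\qquad S_{\mathrm{acc}}(I|E):=\min_{(Q_j)}H(I|J),$$ where $(p_i)$ ranges over probability distributions on the computational basis states of $A$, $(Q_j)$ ranges over POVMs on $E$, and $H(I|J)$ is the Shannon conditional entropy of the joint distribution $\Pr\{I=i,J=j\}=p_i\operatorname{Tr}\rho_iQ_j$.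
   Context: All Hilbert spaces are finite dimensional; $\log$ is to base 2 and entropies are in bits. A quantum channel $\mathcal{N}:\mathcal{L}(A)\to\mathcal{L}(B)$ is a completely positive trace preserving map. It has a Stinespring isometry $V:A\hookrightarrow B\otimes E$ with $\mathcal{N}(\rho)=\operatorname{Tr}_E V\rho V^\dagger$; the complementary channel is $\mathcal{N}^c(\rho)=\operatorname{Tr}_B V\rho V^\dagger$ (unique up to isometries on $E$). Channels whose complement is a cq-channel (also called Schur multipliers) have the form $\mathcal{N}(|i\rangle\langle i'|)=|i\rangle\langle i'|\otimes\operatorname{Tr}_E|\psi_i\rangle\langle\psi_{i'}|$, where $|\psi_i\rangle$ is a purification of $\rho_i$. Codes (with sublinear pre-shared secret, modelled by auxiliary ideal qubit channels). For integers $n\ge 1$, $\kappa\ge 0$, an $(n,\epsilon)$-code with $\kappa$ auxiliary qubits for $\mathcal{N}$ is a collection $\{(\rho_m,D_m): m=1,\dots,N\}$ of states $\rho_m$ on $(\mathbb{C}^2)^{\otimes\kappa}\otimes A^{\otimes n}$ and a POVM $(D_m)$ on $(\mathbb{C}^2)^{\otimes\kappa}\otimes B^{\otimes n}$ ($D_m\ge 0$, $\sum_m D_m=\mathbb{1}$) such that $$\frac1N\sum_{m=1}^N\operatorname{Tr}\Bigl[\bigl(\mathrm{id}_2^{\otimes\kappa}\otimes\mathcal{N}^{\otimes n}\bigr)(\rho_m)\,(\mathbb{1}-D_m)\Bigr]\le\epsilon .$$ Eve's state for message $m$ is $\omega_m=\bigl(\operatorname{Tr}^{\otimes\kappa}\otimes(\mathcal{N}^c)^{\otimes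 n}\bigr)(\rho_m)$ on $E^{\otimes n}$ (the auxiliary qubits are traced out, the complement of an ideal qubit channel being trivial). The code is $\delta$-weakly-locked if for every POVM $(Q_j)$ on $E^{\otimes n}$ there is a probability distribution $(\Omega_j)$ with $$\frac1N\sum_{m=1}^N\sum_j\bigl|\operatorname{Tr}(\omega_m Q_j)-\Omega_j\bigr|\le\delta .$$ The weak locking capacity $L_W(\mathcal{N})$ is the supremum of all $R$ such that, as $n\to\infty$, there exist $\delta_n$-weakly-locked $(n,\epsilon_n)$-codes for $\mathcal{N}$ with $\kappa_n=o(n)$ auxiliary qubits, $N_n\ge 2^{nR}$, and $\epsilon_n,\delta_n\to 0$. *)

theory Defs
  imports
    "HOL-Probability.Information"
    "HOL-Library.Landau_Symbols"
    "Jordan_Normal_Form.Schur_Decomposition"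
begin

unbundle no vec_syntax

text \<open>
  A Hilbert space of dimension \<open>d\<close> is \<open>\<complex>\<^sup>d\<close>, with operators in \<open>carrier_mat d d\<close>. The basis vector
  of a tensor product indexed by \<open>(i, k)\<close>, with \<open>k\<close> below the dimension \<open>d\<close> of the second factor, has
  index \<open>i * d + k\<close>.
\<close>

definition mtrace :: "complex mat \<Rightarrow> complex" where
  "mtrace X = (\<Sum>i<dim_row X. X $$ (i, i))"

definition outer :: "complex vec \<Rightarrow> complex vec \<Rightarrow> complex mat" where
  "outer v w = mat (dim_vec v) (dim_vec w) (\<lambda>(i, j). v $ i * cnj (w $ j))"

definition matrix_unit :: "nat \<Rightarrow> nat \<Rightarrow> nat \<Rightarrow> complex mat" where
  "matrix_unit d i j = outer (unit_vec d i) (unit_vec d j)"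

text \<open>The order on \<open>complex\<close> is the partial one: \<open>0 \<le> z\<close> means that \<open>z\<close> is real and nonnegative.\<close>

definition psd :: "nat \<Rightarrow> complex mat \<Rightarrow> bool" where
  "psd d X \<longleftrightarrow> X \<in> carrier_mat d d \<and> (\<forall>v\<in>carrier_vec d. 0 \<le> (X *\<^sub>v v) \<bullet>c v)"

definition density_operator :: "nat \<Rightarrow> complex mat \<Rightarrow> bool" where
  "density_operator d X \<longleftrightarrow> psd d X \<and> mtrace X = 1"

definition povm :: "nat \<Rightarrow> nat \<Rightarrow> (nat \<Rightarrow> complex mat) \<Rightarrow> bool" where
  "povm d k Q \<longleftrightarrow>
     (\<forall>j<k. psd d (Q j)) \<and> mat d d (\<lambda>rc. \<Sum>j<k. Q j $$ rc) = 1\<^sub>m d"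

definition ptrace_fst :: "nat \<Rightarrow> nat \<Rightarrow> complex mat \<Rightarrow> complex mat" where
  "ptrace_fst d\<^sub>1 d\<^sub>2 X = mat d\<^sub>2 d\<^sub>2 (\<lambda>(k, l). \<Sum>i<d\<^sub>1. X $$ (i * d\<^sub>2 + k, i * d\<^sub>2 + l))"

definition ptrace_snd :: "nat \<Rightarrow> nat \<Rightarrow> complex mat \<Rightarrow> complex mat" where
  "ptrace_snd d\<^sub>1 d\<^sub>2 X = mat d\<^sub>1 d\<^sub>1 (\<lambda>(i, j). \<Sum>k<d\<^sub>2. X $$ (i * d\<^sub>2 + k, j * d\<^sub>2 + k))"

text \<open>
  The tensor product of linear maps \<open>F : L(\<complex>\<^sup>a) \<rightarrow> L(\<complex>\<^sup>a\<^sup>')\<close> and \<open>G : L(\<complex>\<^sup>b) \<rightarrow> L(\<complex>\<^sup>b\<^sup>')\<close>: the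
  linear extension of \<open>|i\<rangle>\<langle>j| \<otimes> |k\<rangle>\<langle>l| \<mapsto> F(|i\<rangle>\<langle>j|) \<otimes> G(|k\<rangle>\<langle>l|)\<close>.
\<close>

definition map_tensor ::
  "nat \<Rightarrow> nat \<Rightarrow> nat \<Rightarrow> nat \<Rightarrow> (complex mat \<Rightarrow> complex mat) \<Rightarrow> (complex mat \<Rightarrow> complex mat) \<Rightarrow>
   complex mat \<Rightarrow> complex mat" where
  "map_tensor a a' b b' F G X = mat (a' * b') (a' * b') (\<lambda>(r, c).
     \<Sum>i<a. \<Sum>j<a. \<Sum>k<b. \<Sum>l<b. X $$ (i * b + k, j * b + l) *
       (F (matrix_unit a i j) $$ (r div b', c div b') * G (matrix_unit b k l) $$ (r mod b', c mod b')))"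

primrec map_tensor_pow ::
  "nat \<Rightarrow> nat \<Rightarrow> (complex mat \<Rightarrow> complex mat) \<Rightarrow> nat \<Rightarrow> complex mat \<Rightarrow> complex mat" where
  "map_tensor_pow a a' F 0 = (\<lambda>X. X)"
| "map_tensor_pow a a' F (Suc n) = map_tensor a a' (a ^ n) (a' ^ n) F (map_tensor_pow a a' F n)"

definition linear_map :: "nat \<Rightarrow> nat \<Rightarrow> (complex mat \<Rightarrow> complex mat) \<Rightarrow> bool" where
  "linear_map a a' F \<longleftrightarrow>
     (\<forall>X\<in>carrier_mat a a. F X \<in> carrier_mat a' a') \<and>
     (\<forall>X\<in>carrier_mat a a. \<forall>Y\<in>carrier_mat a a. F (X + Y) = F X + F Y) \<and>
     (\<forall>X\<in>carrier_mat a a. \<forall>c. F (c \<cdot>\<^sub>m X) = c \<cdot>\<^sub>m F X)"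

definition completely_positive :: "nat \<Rightarrow> nat \<Rightarrow> (complex mat \<Rightarrow> complex mat) \<Rightarrow> bool" where
  "completely_positive a a' F \<longleftrightarrow>
     (\<forall>k X. psd (k * a) X \<longrightarrow> psd (k * a') (map_tensor k k a a' (\<lambda>Y. Y) F X))"

definition quantum_channel :: "nat \<Rightarrow> nat \<Rightarrow> (complex mat \<Rightarrow> complex mat) \<Rightarrow> bool" where
  "quantum_channel a a' F \<longleftrightarrow> linear_map a a' F \<and> completely_positive a a' F \<and>
     (\<forall>X\<in>carrier_mat a a. mtrace (F X) = mtrace X)"

text \<open>\<open>Nc\<close> is the complement of \<open>N : L(A) \<rightarrow> L(B)\<close> for some Stinespring isometry \<open>A \<rightarrow> B \<otimes> E\<close>.\<close>

definition complementary_channel ::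
  "nat \<Rightarrow> nat \<Rightarrow> nat \<Rightarrow> (complex mat \<Rightarrow> complex mat) \<Rightarrow> (complex mat \<Rightarrow> complex mat) \<Rightarrow> bool" where
  "complementary_channel dA dB dE N Nc \<longleftrightarrow>
     (\<exists>V\<in>carrier_mat (dB * dE) dA. mat_adjoint V * V = 1\<^sub>m dA \<and>
        (\<forall>X\<in>carrier_mat dA dA.
           N X = ptrace_snd dB dE (V * X * mat_adjoint V) \<and>
           Nc X = ptrace_fst dB dE (V * X * mat_adjoint V)))"

definition orthonormal_basis :: "nat \<Rightarrow> (nat \<Rightarrow> complex vec) \<Rightarrow> bool" where
  "orthonormal_basis d e \<longleftrightarrow>
     (\<forall>i<d. e i \<in> carrier_vec d) \<and> (\<forall>i<d. \<forall>j<d. e i \<bullet>c e j = (if i = j then 1 else 0))"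

definition cq_channel ::
  "nat \<Rightarrow> nat \<Rightarrow> (complex mat \<Rightarrow> complex mat) \<Rightarrow> (nat \<Rightarrow> complex vec) \<Rightarrow> (nat \<Rightarrow> complex mat) \<Rightarrow> bool"
where
  "cq_channel dA dE F e \<rho> \<longleftrightarrow> linear_map dA dE F \<and> orthonormal_basis dA e \<and>
     (\<forall>i<dA. density_operator dE (\<rho> i)) \<and>
     (\<forall>i<dA. \<forall>i'<dA. F (outer (e i) (e i')) = (if i = i' then \<rho> i else 0\<^sub>m dE dE))"

definition prob_vector :: "nat \<Rightarrow> (nat \<Rightarrow> real) \<Rightarrow> bool" where
  "prob_vector k p \<longleftrightarrow> (\<forall>j<k. 0 \<le> p j) \<and> (\<Sum>j<k. p j) = 1"

text \<open>Messages are numbered from 0. \<open>\<kappa>\<close> is the number of auxiliary ideal qubit channels.\<close>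

definition bob_output ::
  "nat \<Rightarrow> nat \<Rightarrow> (complex mat \<Rightarrow> complex mat) \<Rightarrow> nat \<Rightarrow> nat \<Rightarrow> complex mat \<Rightarrow> complex mat" where
  "bob_output dA dB N n \<kappa> =
     map_tensor (2 ^ \<kappa>) (2 ^ \<kappa>) (dA ^ n) (dB ^ n)
       (map_tensor_pow 2 2 (\<lambda>X. X) \<kappa>) (map_tensor_pow dA dB N n)"

text \<open>
  The trace is a map into \<open>L(\<complex>\<^sup>1)\<close>; Eve's operators then have dimension \<open>1 ^ \<kappa> * dE ^ n = dE ^ n\<close>.
\<close>

definition eve_output ::
  "nat \<Rightarrow> nat \<Rightarrow> (complex mat \<Rightarrow> complex mat) \<Rightarrow> nat \<Rightarrow> nat \<Rightarrow> complex mat \<Rightarrow> complex mat" where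
  "eve_output dA dE Nc n \<kappa> =
     map_tensor (2 ^ \<kappa>) (1 ^ \<kappa>) (dA ^ n) (dE ^ n)
       (map_tensor_pow 2 1 (\<lambda>X. mat 1 1 (\<lambda>_. mtrace X)) \<kappa>) (map_tensor_pow dA dE Nc n)"

definition is_code ::
  "nat \<Rightarrow> nat \<Rightarrow> (complex mat \<Rightarrow> complex mat) \<Rightarrow> nat \<Rightarrow> nat \<Rightarrow> real \<Rightarrow> nat \<Rightarrow>
   (nat \<Rightarrow> complex mat) \<Rightarrow> (nat \<Rightarrow> complex mat) \<Rightarrow> bool" where
  "is_code dA dB N n \<kappa> \<epsilon> M \<rho> D \<longleftrightarrow> 1 \<le> n \<and> 1 \<le> M \<and>
     (\<forall>m<M. density_operator (2 ^ \<kappa> * dA ^ n) (\<rho> m)) \<and>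
     povm (2 ^ \<kappa> * dB ^ n) M D \<and>
     1 / real M * (\<Sum>m<M. Re (mtrace (bob_output dA dB N n \<kappa> (\<rho> m) *
                                     (1\<^sub>m (2 ^ \<kappa> * dB ^ n) - D m)))) \<le> \<epsilon>"

definition weakly_locked ::
  "nat \<Rightarrow> nat \<Rightarrow> (complex mat \<Rightarrow> complex mat) \<Rightarrow> nat \<Rightarrow> nat \<Rightarrow> real \<Rightarrow> nat \<Rightarrow>
   (nat \<Rightarrow> complex mat) \<Rightarrow> bool" where
  "weakly_locked dA dE Nc n \<kappa> \<delta> M \<rho> \<longleftrightarrow>
     (\<forall>k Q. povm (dE ^ n) k Q \<longrightarrow>
        (\<exists>\<Omega>. prob_vector k \<Omega> \<and>
           1 / real M * (\<Sum>m<M. \<Sum>j<k.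
             cmod (mtrace (eve_output dA dE Nc n \<kappa> (\<rho> m) * Q j) - of_real (\<Omega> j))) \<le> \<delta>))"

definition achievable_rate ::
  "nat \<Rightarrow> nat \<Rightarrow> nat \<Rightarrow> (complex mat \<Rightarrow> complex mat) \<Rightarrow> (complex mat \<Rightarrow> complex mat) \<Rightarrow>
   real \<Rightarrow> bool" where
  "achievable_rate dA dB dE N Nc R \<longleftrightarrow>
     (\<exists>(\<kappa> :: nat \<Rightarrow> nat) (\<epsilon> :: nat \<Rightarrow> real) (\<delta> :: nat \<Rightarrow> real) (M :: nat \<Rightarrow> nat) \<rho> D.
        (\<lambda>n. real (\<kappa> n)) \<in> o(\<lambda>n. real n) \<and> \<epsilon> \<longlonglongrightarrow> 0 \<and> \<delta> \<longlonglongrightarrow> 0 \<and>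
        (\<forall>\<^sub>F n in sequentially.
           is_code dA dB N n (\<kappa> n) (\<epsilon> n) (M n) (\<rho> n) (D n) \<and>
           weakly_locked dA dE Nc n (\<kappa> n) (\<delta> n) (M n) (\<rho> n) \<and>
           2 powr (real n * R) \<le> real (M n)))"

text \<open>Suprema and infima are taken in \<open>ereal\<close>, so that they need no boundedness side conditions.\<close>

definition weak_locking_capacity ::
  "nat \<Rightarrow> nat \<Rightarrow> nat \<Rightarrow> (complex mat \<Rightarrow> complex mat) \<Rightarrow> (complex mat \<Rightarrow> complex mat) \<Rightarrow> ereal" where
  "weak_locking_capacity dA dB dE N Nc = (SUP R \<in> {R. achievable_rate dA dB dE N Nc R}. ereal R)"

text \<open>
  \<open>H(I|J)\<close> in bits, for random variables \<open>I\<close> in \<open>{..<a}\<close> and \<open>J\<close> in \<open>{..<k}\<close> with joint probabilities \<open>q\<close>.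
\<close>

definition shannon_cond_entropy :: "nat \<Rightarrow> nat \<Rightarrow> (nat \<times> nat \<Rightarrow> real) \<Rightarrow> real" where
  "shannon_cond_entropy a k q =
     prob_space.conditional_entropy (point_measure ({..<a} \<times> {..<k}) (\<lambda>ij. ennreal (q ij)))
       2 (count_space {..<a}) (count_space {..<k}) fst snd"

lemma shannon_cond_entropy_eq:
  assumes nonneg: "\<And>i j. i < a \<Longrightarrow> j < k \<Longrightarrow> 0 \<le> q (i, j)"
    and total: "(\<Sum>i<a. \<Sum>j<k. q (i, j)) = 1"
  shows "shannon_cond_entropy a k q =
    - (\<Sum>i<a. \<Sum>j<k. q (i, j) * log 2 (q (i, j) / (\<Sum>i'<a. q (i', j))))"
proof -
  let ?A = "{..<a} \<times> {..<k}"
  define M where "M = point_measure ?A (\<lambda>ij. ennreal (q ij))"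
  define r where "r j = (\<Sum>i<a. q (i, j))" for j
  have nn: "0 \<le> q x" if "x \<in> ?A" for x using that nonneg by (cases x) auto
  have sumA: "(\<Sum>x\<in>?A. q x) = 1"
    using total by (simp add: sum.cartesian_product)
  have spM: "space M = ?A" by (simp add: M_def space_point_measure)
  have setsM: "sets M = Pow ?A" by (simp add: M_def sets_point_measure)
  have em: "emeasure M X = ennreal (\<Sum>x\<in>X. q x)" if "X \<subseteq> ?A" for X
    unfolding M_def using that nn
    by (subst emeasure_point_measure_finite2) (auto intro!: sum_ennreal intro: finite_subset[of X ?A])
  have ps: "prob_space M"
    by (rule prob_spaceI) (simp add: spM em sumA)
  interpret information_space M 2
    by (intro information_space.intro ps) (simp add: information_space_axioms_def)
  have prod: "count_space {..<a} \<Otimes>\<^sub>M count_space {..<k} = count_space ?A"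
    by (simp add: pair_measure_count_space)
  have dXY: "distributed M (count_space {..<a} \<Otimes>\<^sub>M count_space {..<k}) (\<lambda>x. (fst x, snd x)) q"
    unfolding distributed_def prod
  proof (intro conjI)
    show meas: "(\<lambda>x. (fst x, snd x)) \<in> M \<rightarrow>\<^sub>M count_space ?A"
      by (auto simp: measurable_def spM setsM)
    show "distr M (count_space ?A) (\<lambda>x. (fst x, snd x)) = density (count_space ?A) (\<lambda>x. ennreal (q x))"
      by (simp add: M_def point_measure_def distr_id2)
  qed simp
  have dY: "distributed M (count_space {..<k}) snd r"
    unfolding distributed_def
  proof (intro conjI)
    show meas: "snd \<in> M \<rightarrow>\<^sub>M count_space {..<k}"
      by (auto simp: measurable_def spM setsM)
    show "distr M (count_space {..<k}) snd = density (count_space {..<k}) (\<lambda>x. ennreal (r x))"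
    proof (rule measure_eqI_finite[of _ "{..<k}"])
      fix j assume j: "j \<in> {..<k}"
      have pre: "snd -` {j} \<inter> space M = (\<lambda>i. (i, j)) ` {..<a}"
        using j by (auto simp: spM)
      have "emeasure (distr M (count_space {..<k}) snd) {j} = ennreal (r j)"
        using j by (simp add: emeasure_distr[OF meas] pre)
          (subst em, auto simp: r_def sum.reindex inj_on_def)
      also have "\<dots> = emeasure (density (count_space {..<k}) (\<lambda>x. ennreal (r x))) {j}"
        using j by (simp add: emeasure_density nn_integral_count_space_finite indicator_def
            if_distrib[of "\<lambda>x. _ * x"] cong: if_cong)
      finally show "emeasure (distr M (count_space {..<k}) snd) {j} =
        emeasure (density (count_space {..<k}) (\<lambda>x. ennreal (r x))) {j}" .
    qed auto
  qed simp
  have "conditional_entropy 2 (count_space {..<a}) (count_space {..<k}) fst snd =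
     - (\<integral>(x, y). q (x, y) * log 2 (q (x, y) / r y) \<partial>(count_space {..<a} \<Otimes>\<^sub>M count_space {..<k}))"
    by (rule conditional_entropy_generic_eq)
      (use dXY dY in \<open>auto intro!: sigma_finite_measure_count_space_finite sum_nonneg
        simp: r_def nonneg\<close>)
  also have "\<dots> = - (\<Sum>(x, y)\<in>?A. q (x, y) * log 2 (q (x, y) / r y))"
    unfolding prod by (simp add: lebesgue_integral_count_space_finite)
  also have "\<dots> = - (\<Sum>i<a. \<Sum>j<k. q (i, j) * log 2 (q (i, j) / r j))"
    by (simp add: sum.cartesian_product)
  finally show ?thesis
    unfolding shannon_cond_entropy_def M_def r_def .
qed

definition acc_cond_entropy :: "nat \<Rightarrow> nat \<Rightarrow> (nat \<Rightarrow> real) \<Rightarrow> (nat \<Rightarrow> complex mat) \<Rightarrow> ereal" where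
  "acc_cond_entropy dA dE p \<rho> =
     (INF (k, Q) \<in> {(k, Q). povm dE k Q}.
        ereal (shannon_cond_entropy dA k (\<lambda>(i, j). p i * Re (mtrace (\<rho> i * Q j)))))"

end

theory Submission
  imports Defs
begin

text \<open>
  Refine a measurement of Eve to rank one, with vectors \<open>\<phi>\<^sub>t\<close>. Projecting the environment of the
  Stinespring isometry onto \<open>\<phi>\<^sub>t\<close> yields Kraus operators \<open>B\<^sub>t\<close> of \<open>N\<close>, and because the complement is
  a cq-channel, \<open>B\<^sub>t\<^sup>\<dagger> B\<^sub>t = \<Sum>\<^sub>i w\<^sub>t\<^sub>i |i\<rangle>\<langle>i|\<close> with \<open>w\<^sub>t\<^sub>i = Pr(J = t | I = i)\<close>. Hence, given Eve's outcome,
  Bob's state lives on orthogonal vectors labelled by \<open>i\<close>, and this is inherited by tensor powers.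

  For each outcome \<open>t\<close> keep the set \<open>S\<^sub>t\<close> of inputs whose conditional probability given \<open>t\<close> is at
  least \<open>2\<^bsup>-A\<^esup>\<close>; it has at most \<open>2\<^bsup>A\<^esup>\<close> elements. Splitting the success amplitude along \<open>S\<^sub>t\<close> gives
  \<open>\<surd>(1 - \<epsilon>) \<le> \<surd>(2\<^bsup>A\<^esup> / M + \<delta>) + \<surd>Pr(I \<notin> S\<^sub>J)\<close>: locking replaces the probability of \<open>t\<close> given the
  message by \<open>\<Omega>\<^sub>t\<close>, and the rest of the first term is a dimension count. By Markov's inequality the
  second probability is at most \<open>(\<kappa> + n h) / A\<close>, where Eve measures each of the \<open>n\<close> systems with one
  POVM that is nearly optimal for the letter-averaged input distribution. Taking \<open>A = n r\<close> with
  \<open>h < r < R\<close> gives \<open>1 \<le> h / r\<close> in the limit, a contradiction. No quantum entropy is needed.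
\<close>

subsection \<open>A one-shot converse\<close>

text \<open>Pythagoras for columns that are orthogonal but not normalised: expanding the square
  leaves only the diagonal Gram entries \<open>w p\<close>. It serves for Kraus images with
  arbitrary weights and, with weight 1, for resolutions of the identity.\<close>

lemma norm_sum_orthogonal:
  fixes z :: "nat \<Rightarrow> complex" and a :: "'j \<Rightarrow> nat \<Rightarrow> complex" and w :: "nat \<Rightarrow> real"
  assumes orth: "\<And>p q. p \<in> A \<Longrightarrow> q \<in> A \<Longrightarrow>
      (\<Sum>j\<in>J. a j p * cnj (a j q)) = (if p = q then of_real (w p) else 0)"
    and fin: "finite A"
  shows "(\<Sum>j\<in>J. (cmod (\<Sum>p\<in>A. z p * a j p))\<^sup>2) = (\<Sum>p\<in>A. (cmod (z p))\<^sup>2 * w p)"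
proof -
  have "complex_of_real (\<Sum>j\<in>J. (cmod (\<Sum>p\<in>A. z p * a j p))\<^sup>2)
      = (\<Sum>j\<in>J. (\<Sum>p\<in>A. z p * a j p) * cnj (\<Sum>q\<in>A. z q * a j q))"
    by (simp only: of_real_sum complex_norm_square)
  also have "\<dots> = (\<Sum>j\<in>J. \<Sum>p\<in>A. \<Sum>q\<in>A. z p * cnj (z q) * (a j p * cnj (a j q)))"
    by (simp add: sum_product cnj_sum mult_ac)
  also have "\<dots> = (\<Sum>p\<in>A. \<Sum>q\<in>A. z p * cnj (z q) * (\<Sum>j\<in>J. a j p * cnj (a j q)))"
    by (subst sum.swap, rule sum.cong[OF refl], subst sum.swap) (simp add: sum_distrib_left)
  also have "\<dots> = (\<Sum>p\<in>A. \<Sum>q\<in>A. if p = q then z p * cnj (z q) * of_real (w p) else 0)"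
    by (intro sum.cong refl) (simp add: orth)
  also have "\<dots> = (\<Sum>p\<in>A. z p * cnj (z p) * of_real (w p))"
    using fin by (simp add: sum.delta)
  also have "\<dots> = complex_of_real (\<Sum>p\<in>A. (cmod (z p))\<^sup>2 * w p)"
    by (simp only: of_real_sum of_real_mult complex_norm_square)
  finally show ?thesis using of_real_eq_iff by blast
qed

text \<open>Cauchy-Schwarz after inserting \<open>sqrt (w x) / sqrt (w x)\<close>. Where
  \<open>w x = 0\<close> the quotient is 0 by convention, and \<open>g0\<close> makes the term on
  the left vanish as well.\<close>

lemma cmod_sum_mult_le:
  fixes z g :: "nat \<Rightarrow> complex" and w :: "nat \<Rightarrow> real"
  assumes w: "\<And>x. x \<in> A \<Longrightarrow> 0 \<le> w x" and g0: "\<And>x. x \<in> A \<Longrightarrow> w x = 0 \<Longrightarrow> g x = 0"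
  shows "(cmod (\<Sum>x\<in>A. z x * g x))\<^sup>2 \<le> (\<Sum>x\<in>A. (cmod (z x))\<^sup>2 * w x) * (\<Sum>x\<in>A. (cmod (g x))\<^sup>2 / w x)"
proof -
  have "cmod (\<Sum>x\<in>A. z x * g x) \<le> (\<Sum>x\<in>A. \<bar>cmod (z x) * sqrt (w x)\<bar> * \<bar>cmod (g x) / sqrt (w x)\<bar>)"
  proof (rule order_trans[OF norm_sum], rule sum_mono)
    fix x assume x: "x \<in> A"
    show "cmod (z x * g x) \<le> \<bar>cmod (z x) * sqrt (w x)\<bar> * \<bar>cmod (g x) / sqrt (w x)\<bar>"
      using w[OF x] g0[OF x] by (cases "w x = 0") (auto simp: norm_mult abs_mult)
  qed
  also have "\<dots> \<le> L2_set (\<lambda>x. cmod (z x) * sqrt (w x)) A * L2_set (\<lambda>x. cmod (g x) / sqrt (w x)) A"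
    by (rule L2_set_mult_ineq)
  finally have "(cmod (\<Sum>x\<in>A. z x * g x))\<^sup>2 \<le>
      (L2_set (\<lambda>x. cmod (z x) * sqrt (w x)) A * L2_set (\<lambda>x. cmod (g x) / sqrt (w x)) A)\<^sup>2"
    by (rule power_mono) simp
  also have "\<dots> = (\<Sum>x\<in>A. (cmod (z x) * sqrt (w x))\<^sup>2) * (\<Sum>x\<in>A. (cmod (g x) / sqrt (w x))\<^sup>2)"
    by (simp add: L2_set_def power_mult_distrib sum_nonneg)
  also have "\<dots> = (\<Sum>x\<in>A. (cmod (z x))\<^sup>2 * w x) * (\<Sum>x\<in>A. (cmod (g x))\<^sup>2 / w x)"
    using w by (simp add: power_mult_distrib power_divide)
  finally show ?thesis .
qed

text \<open>
  \<open>c m s\<close> are the amplitudes of an ensemble decomposition of the state of message \<open>m\<close>, \<open>b t x\<close> the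
  images of the basis vectors under the Kraus operator \<open>t\<close>, and \<open>d m l\<close> decomposes Bob's POVM
  element \<open>m\<close>. Everything is summed, not averaged, over the messages.
\<close>

lemma one_shot_converse:
  fixes c :: "nat \<Rightarrow> nat \<Rightarrow> nat \<Rightarrow> complex" and d :: "nat \<Rightarrow> nat \<Rightarrow> nat \<Rightarrow> complex"
    and b :: "nat \<Rightarrow> nat \<Rightarrow> nat \<Rightarrow> complex" and w :: "nat \<Rightarrow> nat \<Rightarrow> real" and \<Omega> :: "nat \<Rightarrow> real"
    and S :: "nat \<Rightarrow> nat set" and ns :: nat
  defines "p \<equiv> \<lambda>m x. \<Sum>s<ns. (cmod (c m s x))\<^sup>2"
  assumes orth: "\<And>t x x'. t < k \<Longrightarrow> x < n \<Longrightarrow> x' < n \<Longrightarrow>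
      (\<Sum>y<n'. b t x y * cnj (b t x' y)) = (if x = x' then of_real (w t x) else 0)"
    and res: "\<And>y y'. y < n' \<Longrightarrow> y' < n' \<Longrightarrow>
      (\<Sum>m<M. \<Sum>l<nl. d m l y * cnj (d m l y')) = (if y = y' then 1 else 0)"
    and lock: "(\<Sum>m<M. \<Sum>t<k. \<bar>(\<Sum>x<n. p m x * w t x) - \<Omega> t\<bar>) \<le> \<delta>"
    and \<Omega>: "\<And>t. t < k \<Longrightarrow> 0 \<le> \<Omega> t" "(\<Sum>t<k. \<Omega> t) = 1"
    and S: "\<And>t. t < k \<Longrightarrow> S t \<subseteq> {..<n}" "\<And>t. t < k \<Longrightarrow> real (card (S t)) \<le> K"
  shows "sqrt (\<Sum>m<M. \<Sum>t<k. \<Sum>s<ns. \<Sum>l<nl.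
            (cmod (\<Sum>x<n. c m s x * (\<Sum>y<n'. b t x y * cnj (d m l y))))\<^sup>2)
      \<le> sqrt (K + \<delta>) + sqrt (\<Sum>m<M. \<Sum>t<k. \<Sum>x\<in>{..<n} - S t. p m x * w t x)"
proof -
  \<comment> \<open>The amplitude of the POVM vector \<open>d m l\<close> on the image of the basis
    input \<open>x\<close> under the Kraus operator \<open>t\<close>.\<close>
  define g where "g m l t x = (\<Sum>y<n'. b t x y * cnj (d m l y))" for m l t x
  define P where "P m t = (\<Sum>x<n. p m x * w t x)" for m t
  \<comment> \<open>This is the trace of Bob's element \<open>m\<close> on the span of the
    normalised images of the inputs in \<open>S t\<close>; inputs of zero weight contribute
    0.\<close>
  define G where "G m t = (\<Sum>l<nl. \<Sum>x\<in>S t. (cmod (g m l t x))\<^sup>2 / w t x)" for m t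
  define T where "T m t = (\<Sum>s<ns. \<Sum>l<nl. (cmod (\<Sum>x\<in>S t. c m s x * g m l t x))\<^sup>2)" for m t
  have p0: "0 \<le> p m x" for m x unfolding p_def by (rule sum_nonneg) simp
  have wb: "w t x = (\<Sum>y<n'. (cmod (b t x y))\<^sup>2)" if "t < k" "x < n" for t x
  proof -
    have "complex_of_real (w t x) = of_real (\<Sum>y<n'. (cmod (b t x y))\<^sup>2)"
      using orth[of t x x] that by (simp only: of_real_sum complex_norm_square) simp
    then show ?thesis using of_real_eq_iff by blast
  qed
  have w0: "0 \<le> w t x" if "t < k" "x < n" for t x
    unfolding wb[OF that] by (rule sum_nonneg) simp
  have g0: "g m l t x = 0" if "t < k" "x < n" "w t x = 0" for m l t x
  proof -
    have "\<forall>y<n'. b t x y = 0"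
      using that(3) unfolding wb[OF that(1,2)] by (subst (asm) sum_nonneg_eq_0_iff) auto
    then show ?thesis unfolding g_def by simp
  qed
  \<comment> \<open>Summed over all messages the POVM resolves the identity, so \<open>d\<close>
    drops out; orthogonality of the Kraus images then removes the cross terms.\<close>
  have pars: "(\<Sum>m<M. \<Sum>l<nl. (cmod (\<Sum>x\<in>A. z x * g m l t x))\<^sup>2) = (\<Sum>x\<in>A. (cmod (z x))\<^sup>2 * w t x)"
    if t: "t < k" and A: "A \<subseteq> {..<n}" for t z A
  proof -
    have fA: "finite A" using A finite_subset by blast
    have "(\<Sum>x\<in>A. z x * g m l t x) = (\<Sum>y<n'. (\<Sum>x\<in>A. z x * b t x y) * cnj (d m l y))" for m l
      unfolding g_def by (simp add: sum_distrib_left sum_distrib_right mult.assoc)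
        (rule sum.swap)
    then have "(\<Sum>m<M. \<Sum>l<nl. (cmod (\<Sum>x\<in>A. z x * g m l t x))\<^sup>2)
      = (\<Sum>j\<in>{..<M} \<times> {..<nl}. (cmod (\<Sum>y<n'. (\<Sum>x\<in>A. z x * b t x y) * cnj (d (fst j) (snd j) y)))\<^sup>2)"
      by (simp add: sum.cartesian_product case_prod_beta)
    also have "\<dots> = (\<Sum>y<n'. (cmod (\<Sum>x\<in>A. z x * b t x y))\<^sup>2 * 1)"
    proof (rule norm_sum_orthogonal)
      fix y y' assume yy: "y \<in> {..<n'}" "y' \<in> {..<n'}"
      have "(\<Sum>j\<in>{..<M} \<times> {..<nl}. cnj (d (fst j) (snd j) y) * cnj (cnj (d (fst j) (snd j) y')))
         = cnj (\<Sum>m<M. \<Sum>l<nl. d m l y * cnj (d m l y'))"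
        by (simp add: sum.cartesian_product case_prod_beta)
      also have "\<dots> = cnj (if y = y' then 1 else 0)"
        using yy by (subst res) auto
      finally show "(\<Sum>j\<in>{..<M} \<times> {..<nl}. cnj (d (fst j) (snd j) y) * cnj (cnj (d (fst j) (snd j) y')))
         = (if y = y' then complex_of_real 1 else 0)"
        by simp
    qed simp
    also have "\<dots> = (\<Sum>x\<in>A. (cmod (z x))\<^sup>2 * w t x)"
      using norm_sum_orthogonal[of A "\<lambda>y x. b t x y" "{..<n'}" "w t" z] orth t A fA by (simp add: subset_iff)
    finally show ?thesis .
  qed
  have part: "(\<Sum>l<nl. (cmod (\<Sum>x\<in>A. z x * g m l t x))\<^sup>2) \<le> (\<Sum>x\<in>A. (cmod (z x))\<^sup>2 * w t x)"
    if "t < k" "A \<subseteq> {..<n}" "m < M" for t z A m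
    unfolding pars[OF that(1,2), symmetric]
    by (rule member_le_sum[where f="\<lambda>m. \<Sum>l<nl. (cmod (\<Sum>x\<in>A. z x * g m l t x))\<^sup>2"])
      (use that in \<open>auto intro: sum_nonneg\<close>)
  have parts: "(\<Sum>s<ns. \<Sum>l<nl. (cmod (\<Sum>x\<in>A. c m s x * g m l t x))\<^sup>2) \<le> (\<Sum>x\<in>A. p m x * w t x)"
    if "t < k" "A \<subseteq> {..<n}" "m < M" for t A m
  proof -
    have "(\<Sum>s<ns. \<Sum>l<nl. (cmod (\<Sum>x\<in>A. c m s x * g m l t x))\<^sup>2)
        \<le> (\<Sum>s<ns. \<Sum>x\<in>A. (cmod (c m s x))\<^sup>2 * w t x)"
      by (intro sum_mono part that)
    also have "\<dots> = (\<Sum>x\<in>A. p m x * w t x)"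
      unfolding p_def sum_distrib_right by (rule sum.swap)
    finally show ?thesis .
  qed
  have G0: "0 \<le> G m t" if "t < k" for m t
    unfolding G_def using S(1)[OF that] w0[OF that] by (intro sum_nonneg divide_nonneg_nonneg) auto
  have P0: "0 \<le> P m t" if "t < k" for m t
    unfolding P_def using w0[OF that] p0 by (intro sum_nonneg mult_nonneg_nonneg) auto
  have PS: "(\<Sum>x\<in>S t. p m x * w t x) \<le> P m t" if "t < k" for m t
    unfolding P_def using S(1)[OF that] w0[OF that] p0 by (intro sum_mono2) auto
  have T1: "T m t \<le> P m t" if "t < k" "m < M" for m t
    unfolding T_def using parts[OF that(1) S(1)[OF that(1)] that(2)] PS[OF that(1)] by (rule order_trans)
  \<comment> \<open>Cauchy-Schwarz separates the input amplitudes, which give the outcome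
    probability \<open>P\<close>, from Bob's amplitudes, which give \<open>G\<close>.\<close>
  have T2: "T m t \<le> P m t * G m t" if t: "t < k" for m t
  proof -
    have "T m t \<le> (\<Sum>s<ns. \<Sum>l<nl. (\<Sum>x\<in>S t. (cmod (c m s x))\<^sup>2 * w t x) * (\<Sum>x\<in>S t. (cmod (g m l t x))\<^sup>2 / w t x))"
      unfolding T_def using S(1)[OF t] w0[OF t] g0[OF t] by (intro sum_mono cmod_sum_mult_le) auto
    also have "\<dots> = (\<Sum>s<ns. \<Sum>x\<in>S t. (cmod (c m s x))\<^sup>2 * w t x) * G m t"
      unfolding G_def sum_product ..
    also have "(\<Sum>s<ns. \<Sum>x\<in>S t. (cmod (c m s x))\<^sup>2 * w t x) = (\<Sum>x\<in>S t. p m x * w t x)"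
      unfolding p_def sum_distrib_right by (rule sum.swap)
    also have "\<dots> * G m t \<le> P m t * G m t"
      by (intro mult_right_mono PS G0 t)
    finally show ?thesis .
  qed
  \<comment> \<open>this is the only place where locking enters, through \<open>T \<le> P min(1, G)\<close>\<close>
  have T3: "T m t \<le> \<Omega> t * G m t + \<bar>P m t - \<Omega> t\<bar>" if t: "t < k" and m: "m < M" for m t
  proof (cases "P m t \<le> \<Omega> t")
    case True
    then have "P m t * G m t \<le> \<Omega> t * G m t" using G0[OF t] by (rule mult_right_mono)
    then show ?thesis using T2[OF t, of m] by linarith
  next
    case False
    show ?thesis
    proof (cases "G m t \<le> 1")
      case True
      have "(P m t - \<Omega> t) * G m t \<le> (P m t - \<Omega> t) * 1"
        using True False by (intro mult_left_mono) auto
      then show ?thesis using T2[OF t, of m] False by (simp add: algebra_simps)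
    next
      case GF: False
      have "\<Omega> t * 1 \<le> \<Omega> t * G m t" using GF \<Omega>(1)[OF t] by (intro mult_left_mono) auto
      then show ?thesis using T1[OF t m] False by simp
    qed
  qed
  \<comment> \<open>The dimension count: the POVM sums to the identity, so each \<open>x\<close> in
    \<open>S t\<close> contributes \<open>w t x / w t x\<close>, which is 1, or 0 at zero
    weight.\<close>
  have Gsum: "(\<Sum>m<M. G m t) \<le> K" if t: "t < k" for t
  proof -
    have "(\<Sum>m<M. G m t) = (\<Sum>m<M. \<Sum>x\<in>S t. \<Sum>l<nl. (cmod (g m l t x))\<^sup>2 / w t x)"
      unfolding G_def by (intro sum.cong refl sum.swap)
    also have "\<dots> = (\<Sum>x\<in>S t. \<Sum>m<M. \<Sum>l<nl. (cmod (g m l t x))\<^sup>2 / w t x)"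
      by (rule sum.swap)
    also have "\<dots> = (\<Sum>x\<in>S t. w t x / w t x)"
    proof (rule sum.cong[OF refl])
      fix x assume x: "x \<in> S t"
      have "(\<Sum>m<M. \<Sum>l<nl. (cmod (g m l t x))\<^sup>2) = w t x"
        using pars[OF t, of "{x}" "\<lambda>_. 1"] x S(1)[OF t] by auto
      then show "(\<Sum>m<M. \<Sum>l<nl. (cmod (g m l t x))\<^sup>2 / w t x) = w t x / w t x"
        by (simp add: sum_divide_distrib[symmetric])
    qed
    also have "\<dots> \<le> (\<Sum>x\<in>S t. 1)" by (rule sum_mono) simp
    finally show ?thesis using S(2)[OF t] by simp
  qed
  have Tsum: "(\<Sum>m<M. \<Sum>t<k. T m t) \<le> K + \<delta>"
  proof -
    have "(\<Sum>m<M. \<Sum>t<k. T m t) \<le> (\<Sum>m<M. \<Sum>t<k. \<Omega> t * G m t + \<bar>P m t - \<Omega> t\<bar>)"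
      by (intro sum_mono T3) auto
    also have "\<dots> = (\<Sum>m<M. \<Sum>t<k. \<Omega> t * G m t) + (\<Sum>m<M. \<Sum>t<k. \<bar>P m t - \<Omega> t\<bar>)"
      by (simp add: sum.distrib)
    also have "(\<Sum>m<M. \<Sum>t<k. \<Omega> t * G m t) = (\<Sum>t<k. \<Omega> t * (\<Sum>m<M. G m t))"
      unfolding sum_distrib_left by (rule sum.swap)
    also have "\<dots> \<le> (\<Sum>t<k. \<Omega> t * K)"
      using \<Omega>(1) Gsum by (intro sum_mono mult_left_mono) auto
    also have "\<dots> = K" using \<Omega>(2) by (simp add: sum_distrib_right[symmetric])
    finally show ?thesis using lock unfolding P_def by linarith
  qed
  let ?I = "{..<M} \<times> {..<k} \<times> {..<ns} \<times> {..<nl}"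
  let ?f = "\<lambda>A (m, t, s, l). cmod (\<Sum>x\<in>A t. c m s x * g m l t x)"
  have L2: "L2_set (?f A) ?I = sqrt (\<Sum>m<M. \<Sum>t<k. \<Sum>s<ns. \<Sum>l<nl. (cmod (\<Sum>x\<in>A t. c m s x * g m l t x))\<^sup>2)" for A
    unfolding L2_set_def by (simp add: sum.cartesian_product case_prod_beta)
  \<comment> \<open>The triangle inequality is applied to amplitudes rather than probabilities,
    because the parts of an input inside and outside \<open>S t\<close> may interfere.\<close>
  have "L2_set (?f (\<lambda>_. {..<n})) ?I \<le> L2_set (\<lambda>i. ?f S i + ?f (\<lambda>t. {..<n} - S t) i) ?I"
  proof (rule L2_set_mono)
    fix i assume i: "i \<in> ?I"
    obtain m t s l where i': "i = (m, t, s, l)" by (cases i)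
    have "(\<Sum>x<n. c m s x * g m l t x)
        = (\<Sum>x\<in>S t. c m s x * g m l t x) + (\<Sum>x\<in>{..<n} - S t. c m s x * g m l t x)"
      using S(1)[of t] i i' by (subst add.commute, intro sum.subset_diff) auto
    then show "?f (\<lambda>_. {..<n}) i \<le> ?f S i + ?f (\<lambda>t. {..<n} - S t) i"
      by (simp add: i' norm_triangle_ineq)
  qed (simp add: case_prod_beta)
  also have "\<dots> \<le> L2_set (?f S) ?I + L2_set (?f (\<lambda>t. {..<n} - S t)) ?I"
    by (rule L2_set_triangle_ineq)
  also have "L2_set (?f S) ?I \<le> sqrt (K + \<delta>)"
    unfolding L2 using Tsum unfolding T_def by simp
  also have "L2_set (?f (\<lambda>t. {..<n} - S t)) ?I
      \<le> sqrt (\<Sum>m<M. \<Sum>t<k. \<Sum>x\<in>{..<n} - S t. p m x * w t x)"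
    unfolding L2 by (intro real_sqrt_le_mono sum_mono parts) auto
  finally show ?thesis unfolding L2[of "\<lambda>_. {..<n}"] unfolding g_def by simp
qed

subsection \<open>Kraus operators of tensor products\<close>

lemma sum_lessThan_mult:
  "(\<Sum>p<a * b. f p) = (\<Sum>i<a. \<Sum>k<b. f (i * b + k))" for f :: "nat \<Rightarrow> 'a::comm_monoid_add"
proof -
  have "(\<Sum>p<a * b. f p) = (\<Sum>(i, k)\<in>{..<a} \<times> {..<b}. f (i * b + k))"
  proof (rule sum.reindex_bij_witness[of _ "\<lambda>(i, k). i * b + k" "\<lambda>p. (p div b, p mod b)"])
    fix p assume p: "p \<in> {..<a * b}"
    then have "0 < b" by (cases b) auto
    then show "(p div b, p mod b) \<in> {..<a} \<times> {..<b}"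
      using p by (auto simp: less_mult_imp_div_less)
  next
    fix x assume "x \<in> {..<a} \<times> {..<b}"
    then obtain i k where x: "x = (i, k)" "i < a" "k < b" by auto
    have "i * b + k < Suc i * b" using x by simp
    also have "\<dots> \<le> a * b" using x by (intro mult_right_mono) auto
    finally show "(case x of (i, k) \<Rightarrow> i * b + k) \<in> {..<a * b}" using x by simp
  qed auto
  then show ?thesis by (simp add: sum.cartesian_product)
qed

lemma sum_div_mod:
  fixes f g :: "nat \<Rightarrow> 'a::comm_semiring_0"
  shows "(\<Sum>t<k * l. f (t div l) * g (t mod l)) = (\<Sum>t<k. f t) * (\<Sum>t<l. g t)"
  by (simp add: sum_lessThan_mult sum_product)

lemma div_mod_less:
  fixes t k l :: nat
  assumes "t < k * l" shows "t div l < k" "t mod l < l"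
proof -
  have "0 < l" using assms by (cases l) auto
  then show "t div l < k" "t mod l < l" using assms by (auto simp: less_mult_imp_div_less)
qed

lemma eq_iff_div_mod: "x = y \<longleftrightarrow> x div b = y div b \<and> x mod b = y mod b" for x y b :: nat
  by (metis div_mult_mod_eq)

lemma matrix_unit_index:
  "r < d \<Longrightarrow> s < d \<Longrightarrow> matrix_unit d p q $$ (r, s) = (if r = p \<and> s = q then 1 else 0)"
  by (auto simp: matrix_unit_def outer_def unit_vec_def)

lemma map_tensor_index:
  assumes "r < a' * b'" "c < a' * b'"
  shows "map_tensor a a' b b' F G X $$ (r, c) = (\<Sum>p<a * b. \<Sum>q<a * b. X $$ (p, q) *
    (F (matrix_unit a (p div b) (q div b)) $$ (r div b', c div b') *
     G (matrix_unit b (p mod b) (q mod b)) $$ (r mod b', c mod b')))"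
proof -
  let ?h = "\<lambda>i j k l. X $$ (i * b + k, j * b + l) *
    (F (matrix_unit a i j) $$ (r div b', c div b') * G (matrix_unit b k l) $$ (r mod b', c mod b'))"
  have "map_tensor a a' b b' F G X $$ (r, c) = (\<Sum>i<a. \<Sum>j<a. \<Sum>k<b. \<Sum>l<b. ?h i j k l)"
    using assms by (simp add: map_tensor_def)
  also have "\<dots> = (\<Sum>i<a. \<Sum>k<b. \<Sum>j<a. \<Sum>l<b. ?h i j k l)"
    by (intro sum.cong refl sum.swap)
  also have "\<dots> = (\<Sum>i<a. \<Sum>k<b. \<Sum>j<a. \<Sum>l<b. X $$ (i * b + k, j * b + l) *
    (F (matrix_unit a ((i * b + k) div b) ((j * b + l) div b)) $$ (r div b', c div b') *
     G (matrix_unit b ((i * b + k) mod b) ((j * b + l) mod b)) $$ (r mod b', c mod b')))"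
    by (intro sum.cong refl) simp
  finally show ?thesis unfolding sum_lessThan_mult[of _ a b] .
qed

lemma map_tensor_matrix_unit:
  assumes "p < a * b" "q < a * b" "r < a' * b'" "c < a' * b'"
  shows "map_tensor a a' b b' F G (matrix_unit (a * b) p q) $$ (r, c) =
     F (matrix_unit a (p div b) (q div b)) $$ (r div b', c div b') *
     G (matrix_unit b (p mod b) (q mod b)) $$ (r mod b', c mod b')"
proof -
  let ?h = "\<lambda>p q. F (matrix_unit a (p div b) (q div b)) $$ (r div b', c div b') *
     G (matrix_unit b (p mod b) (q mod b)) $$ (r mod b', c mod b')"
  have "map_tensor a a' b b' F G (matrix_unit (a * b) p q) $$ (r, c) =
     (\<Sum>p'<a * b. \<Sum>q'<a * b. matrix_unit (a * b) p q $$ (p', q') * ?h p' q')"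
    by (rule map_tensor_index[OF assms(3,4)])
  also have "\<dots> = (\<Sum>p'<a * b. \<Sum>q'<a * b. if q' = q then (if p' = p then ?h p' q' else 0) else 0)"
    by (intro sum.cong refl) (auto simp: matrix_unit_index)
  also have "\<dots> = ?h p q"
    using assms(1,2) by (simp only: sum.delta finite_lessThan lessThan_iff) simp
  finally show ?thesis .
qed

text \<open>\<open>map_tensor\<close> evaluates \<open>F\<close> and \<open>G\<close> on matrix
  units only, so it is linear by construction, whatever \<open>F\<close> and \<open>G\<close>
  are.\<close>

lemma map_tensor_expand:
  assumes "r < a' * b'" "c < a' * b'"
  shows "map_tensor a a' b b' F G X $$ (r, c) = (\<Sum>p<a * b. \<Sum>q<a * b.
    X $$ (p, q) * map_tensor a a' b b' F G (matrix_unit (a * b) p q) $$ (r, c))"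
  unfolding map_tensor_index[OF assms, of a b F G X]
  by (intro sum.cong refl) (simp add: map_tensor_matrix_unit assms)

text \<open>
  The Kraus operators are stored as \<open>B\<^sub>t = C\<^sub>t U\<^sup>\<dagger>\<close>, where \<open>U i p\<close> is the entry \<open>p\<close> of the basis vector
  \<open>i\<close> and the columns of \<open>C\<^sub>t\<close> are orthogonal with squared norms \<open>w t i\<close>. The second clause says that
  measuring the output of \<open>G\<close> with \<open>|\<phi>\<^sub>t\<rangle>\<langle>\<phi>\<^sub>t|\<close> has the operator \<open>B\<^sub>t\<^sup>\<dagger> B\<^sub>t\<close> on the input.
\<close>

definition kraus_system ::
  "nat \<Rightarrow> nat \<Rightarrow> nat \<Rightarrow> nat \<Rightarrow> (complex mat \<Rightarrow> complex mat) \<Rightarrow> (complex mat \<Rightarrow> complex mat) \<Rightarrow>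
   (nat \<Rightarrow> nat \<Rightarrow> complex) \<Rightarrow> (nat \<Rightarrow> nat \<Rightarrow> nat \<Rightarrow> complex) \<Rightarrow> (nat \<Rightarrow> nat \<Rightarrow> complex) \<Rightarrow>
   (nat \<Rightarrow> nat \<Rightarrow> real) \<Rightarrow> bool" where
  "kraus_system a b e k F G \<phi> C U w \<longleftrightarrow>
    (\<forall>p<a. \<forall>q<a. \<forall>r<b. \<forall>s<b. F (matrix_unit a p q) $$ (r, s) =
      (\<Sum>t<k. (\<Sum>i<a. C t r i * cnj (U i p)) * cnj (\<Sum>i<a. C t s i * cnj (U i q)))) \<and>
    (\<forall>p<a. \<forall>q<a. \<forall>t<k. (\<Sum>x<e. \<Sum>y<e. G (matrix_unit a p q) $$ (x, y) * (\<phi> t y * cnj (\<phi> t x))) =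
      (\<Sum>i<a. complex_of_real (w t i) * (cnj (U i p) * U i q))) \<and>
    (\<forall>t<k. \<forall>i<a. \<forall>j<a. (\<Sum>r<b. C t r i * cnj (C t r j)) = (if i = j then of_real (w t i) else 0)) \<and>
    (\<forall>p<a. \<forall>q<a. (\<Sum>i<a. U i p * cnj (U i q)) = (if p = q then 1 else 0)) \<and>
    (\<forall>x<e. \<forall>y<e. (\<Sum>t<k. \<phi> t x * cnj (\<phi> t y)) = (if x = y then 1 else 0)) \<and>
    (\<forall>i<a. (\<Sum>t<k. w t i) = 1)"

section \<open>Tensor products and powers of Kraus systems\<close>

definition tensor2 :: "nat \<Rightarrow> nat \<Rightarrow> (nat \<Rightarrow> nat \<Rightarrow> 'a::times) \<Rightarrow> (nat \<Rightarrow> nat \<Rightarrow> 'a) \<Rightarrow> nat \<Rightarrow> nat \<Rightarrow> 'a" where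
  "tensor2 k a f g t i = f (t div k) (i div a) * g (t mod k) (i mod a)"

text \<open>As in \<open>tensor2\<close>, only the ranges of the second factor are parameters:
  quotient and remainder by them recover a composite index, in the order used by
  \<open>map_tensor\<close>.\<close>

definition tensor3 :: "nat \<Rightarrow> nat \<Rightarrow> nat \<Rightarrow> (nat \<Rightarrow> nat \<Rightarrow> nat \<Rightarrow> 'a::times) \<Rightarrow>
    (nat \<Rightarrow> nat \<Rightarrow> nat \<Rightarrow> 'a) \<Rightarrow> nat \<Rightarrow> nat \<Rightarrow> nat \<Rightarrow> 'a" where
  "tensor3 k b a f g t r i = f (t div k) (r div b) (i div a) * g (t mod k) (r mod b) (i mod a)"

text \<open>Each clause is a sum over composite indices of a product of two factors, hence a product
  of two sums by \<open>sum_div_mod\<close>. In particular the weights multiply: given the input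
  word, Eve's outcomes for a product measurement are independent.\<close>

lemma kraus_system_tensor:
  assumes K: "kraus_system a b e k F G \<phi> C U w" and K': "kraus_system a' b' e' k' F' G' \<phi>' C' U' w'"
  shows "kraus_system (a * a') (b * b') (e * e') (k * k')
    (map_tensor a b a' b' F F') (map_tensor a e a' e' G G') (tensor2 k' e' \<phi> \<phi>')
    (tensor3 k' b' a' C C') (tensor2 a' a' U U') (tensor2 k' a' w w')"
  unfolding kraus_system_def
proof (intro conjI allI impI)
  \<comment> \<open>The Kraus operators of the product are the tensor products of the Kraus
    operators.\<close>
  have kraus: "(\<Sum>i<a * a'. tensor3 k' b' a' C C' t r i * cnj (tensor2 a' a' U U' i p)) =
     (\<Sum>i<a. C (t div k') (r div b') i * cnj (U i (p div a'))) *
     (\<Sum>i<a'. C' (t mod k') (r mod b') i * cnj (U' i (p mod a')))" for t r p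
    unfolding sum_div_mod[symmetric] tensor2_def tensor3_def by (intro sum.cong refl) simp
  {
    fix p q r s assume *: "p < a * a'" "q < a * a'" "r < b * b'" "s < b * b'"
    show "map_tensor a b a' b' F F' (matrix_unit (a * a') p q) $$ (r, s) =
      (\<Sum>t<k * k'. (\<Sum>i<a * a'. tensor3 k' b' a' C C' t r i * cnj (tensor2 a' a' U U' i p)) *
         cnj (\<Sum>i<a * a'. tensor3 k' b' a' C C' t s i * cnj (tensor2 a' a' U U' i q)))"
    proof -
      let ?f = "\<lambda>t. (\<Sum>i<a. C t (r div b') i * cnj (U i (p div a'))) * cnj (\<Sum>i<a. C t (s div b') i * cnj (U i (q div a')))"
      let ?g = "\<lambda>t. (\<Sum>i<a'. C' t (r mod b') i * cnj (U' i (p mod a'))) * cnj (\<Sum>i<a'. C' t (s mod b') i * cnj (U' i (q mod a')))"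
      have "map_tensor a b a' b' F F' (matrix_unit (a * a') p q) $$ (r, s) = (\<Sum>t<k. ?f t) * (\<Sum>t<k'. ?g t)"
        unfolding map_tensor_matrix_unit[OF *]
        using K K' *[THEN div_mod_less(1)] *[THEN div_mod_less(2)] by (simp add: kraus_system_def)
      also have "\<dots> = (\<Sum>t<k * k'. ?f (t div k') * ?g (t mod k'))"
        by (rule sum_div_mod[symmetric])
      finally show ?thesis unfolding kraus by (simp only: complex_cnj_mult mult_ac)
    qed
  next
    fix p q t assume *: "p < a * a'" "q < a * a'" "t < k * k'"
    let ?f = "\<lambda>x y. G (matrix_unit a (p div a') (q div a')) $$ (x, y) * (\<phi> (t div k') y * cnj (\<phi> (t div k') x))"
    let ?g = "\<lambda>x y. G' (matrix_unit a' (p mod a') (q mod a')) $$ (x, y) * (\<phi>' (t mod k') y * cnj (\<phi>' (t mod k') x))"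
    have "(\<Sum>x<e * e'. \<Sum>y<e * e'. map_tensor a e a' e' G G' (matrix_unit (a * a') p q) $$ (x, y) *
            (tensor2 k' e' \<phi> \<phi>' t y * cnj (tensor2 k' e' \<phi> \<phi>' t x)))
       = (\<Sum>x<e * e'. \<Sum>y<e * e'. ?f (x div e') (y div e') * ?g (x mod e') (y mod e'))"
      by (intro sum.cong refl) (simp add: map_tensor_matrix_unit * tensor2_def)
    also have "\<dots> = (\<Sum>x<e. \<Sum>y<e. ?f x y) * (\<Sum>x<e'. \<Sum>y<e'. ?g x y)"
      unfolding sum_div_mod[symmetric] ..
    also have "\<dots> = (\<Sum>i<a. complex_of_real (w (t div k') i) * (cnj (U i (p div a')) * U i (q div a'))) *
       (\<Sum>i<a'. complex_of_real (w' (t mod k') i) * (cnj (U' i (p mod a')) * U' i (q mod a')))"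
      using K K' *[THEN div_mod_less(1)] *[THEN div_mod_less(2)] by (simp add: kraus_system_def)
    also have "\<dots> = (\<Sum>i<a * a'. complex_of_real (tensor2 k' a' w w' t i) *
        (cnj (tensor2 a' a' U U' i p) * tensor2 a' a' U U' i q))"
      unfolding sum_div_mod[symmetric] tensor2_def by (intro sum.cong refl) simp
    finally show "(\<Sum>x<e * e'. \<Sum>y<e * e'. map_tensor a e a' e' G G' (matrix_unit (a * a') p q) $$ (x, y) *
            (tensor2 k' e' \<phi> \<phi>' t y * cnj (tensor2 k' e' \<phi> \<phi>' t x))) =
        (\<Sum>i<a * a'. complex_of_real (tensor2 k' a' w w' t i) *
        (cnj (tensor2 a' a' U U' i p) * tensor2 a' a' U U' i q))" .
  next
    fix t i j assume *: "t < k * k'" "i < a * a'" "j < a * a'"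
    have "(\<Sum>r<b * b'. tensor3 k' b' a' C C' t r i * cnj (tensor3 k' b' a' C C' t r j)) =
       (\<Sum>r<b. C (t div k') r (i div a') * cnj (C (t div k') r (j div a'))) *
       (\<Sum>r<b'. C' (t mod k') r (i mod a') * cnj (C' (t mod k') r (j mod a')))"
      unfolding sum_div_mod[symmetric] tensor3_def by (intro sum.cong refl) simp
    then show "(\<Sum>r<b * b'. tensor3 k' b' a' C C' t r i * cnj (tensor3 k' b' a' C C' t r j)) =
        (if i = j then complex_of_real (tensor2 k' a' w w' t i) else 0)"
      using K K' *[THEN div_mod_less(1)] *[THEN div_mod_less(2)] eq_iff_div_mod[of i j a']
      by (simp add: kraus_system_def tensor2_def)
  next
    fix p q assume *: "p < a * a'" "q < a * a'"
    have "(\<Sum>i<a * a'. tensor2 a' a' U U' i p * cnj (tensor2 a' a' U U' i q)) =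
       (\<Sum>i<a. U i (p div a') * cnj (U i (q div a'))) * (\<Sum>i<a'. U' i (p mod a') * cnj (U' i (q mod a')))"
      unfolding sum_div_mod[symmetric] tensor2_def by (intro sum.cong refl) simp
    then show "(\<Sum>i<a * a'. tensor2 a' a' U U' i p * cnj (tensor2 a' a' U U' i q)) = (if p = q then 1 else 0)"
      using K K' *[THEN div_mod_less(1)] *[THEN div_mod_less(2)] eq_iff_div_mod[of p q a']
      by (simp add: kraus_system_def)
  next
    fix x y assume *: "x < e * e'" "y < e * e'"
    have "(\<Sum>t<k * k'. tensor2 k' e' \<phi> \<phi>' t x * cnj (tensor2 k' e' \<phi> \<phi>' t y)) =
       (\<Sum>t<k. \<phi> t (x div e') * cnj (\<phi> t (y div e'))) * (\<Sum>t<k'. \<phi>' t (x mod e') * cnj (\<phi>' t (y mod e')))"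
      unfolding sum_div_mod[symmetric] tensor2_def by (intro sum.cong refl) simp
    then show "(\<Sum>t<k * k'. tensor2 k' e' \<phi> \<phi>' t x * cnj (tensor2 k' e' \<phi> \<phi>' t y)) = (if x = y then 1 else 0)"
      using K K' *[THEN div_mod_less(1)] *[THEN div_mod_less(2)] eq_iff_div_mod[of x y e']
      by (simp add: kraus_system_def)
  next
    fix i assume *: "i < a * a'"
    have "(\<Sum>t<k * k'. tensor2 k' a' w w' t i) = (\<Sum>t<k. w t (i div a')) * (\<Sum>t<k'. w' t (i mod a'))"
      unfolding sum_div_mod[symmetric] tensor2_def ..
    then show "(\<Sum>t<k * k'. tensor2 k' a' w w' t i) = 1"
      using K K' *[THEN div_mod_less(1)] *[THEN div_mod_less(2)] by (simp add: kraus_system_def)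
  }
qed

primrec tensor_pow ::
  "nat \<Rightarrow> nat \<Rightarrow> (nat \<Rightarrow> nat \<Rightarrow> 'a) \<Rightarrow> nat \<Rightarrow> nat \<Rightarrow> nat \<Rightarrow> 'a::monoid_mult" where
  "tensor_pow k a w 0 = (\<lambda>t i. 1)"
| "tensor_pow k a w (Suc n) = tensor2 (k ^ n) (a ^ n) w (tensor_pow k a w n)"

text \<open>Only \<open>C\<close> is left existential: later arguments need \<open>U\<close> and
  \<open>w\<close> explicitly, but of \<open>C\<close> only the relations in
  \<open>kraus_system\<close>.\<close>

lemma kraus_system_pow:
  assumes "kraus_system a b e k F G \<phi> C U w"
  shows "\<exists>C. kraus_system (a ^ n) (b ^ n) (e ^ n) (k ^ n)
    (map_tensor_pow a b F n) (map_tensor_pow a e G n)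
    (tensor_pow k e \<phi> n) C (tensor_pow a a U n) (tensor_pow k a w n)"
proof (induction n)
  case 0
  show ?case
    \<comment> \<open>For the power 0 all dimensions are 1, and every amplitude and weight is the
      scalar 1.\<close>
    by (rule exI[of _ "\<lambda>_ _ _. 1"]) (simp add: kraus_system_def matrix_unit_index)
next
  case (Suc n)
  then obtain C' where "kraus_system (a ^ n) (b ^ n) (e ^ n) (k ^ n)
    (map_tensor_pow a b F n) (map_tensor_pow a e G n)
    (tensor_pow k e \<phi> n) C' (tensor_pow a a U n) (tensor_pow k a w n)" by blast
  from kraus_system_tensor[OF assms this] show ?case by auto
qed

text \<open>The orthogonality clause with equal indices exhibits \<open>w t i\<close> as a squared
  column norm.\<close>

lemma kraus_system_nonneg:
  assumes "kraus_system a b e k F G \<phi> C U w" "t < k" "i < a"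
  shows "0 \<le> w t i"
proof -
  have "complex_of_real (w t i) = of_real (\<Sum>r<b. (cmod (C t r i))\<^sup>2)"
    using assms by (simp only: of_real_sum complex_norm_square) (simp add: kraus_system_def)
  then have "w t i = (\<Sum>r<b. (cmod (C t r i))\<^sup>2)" using of_real_eq_iff by blast
  then show ?thesis by (simp add: sum_nonneg)
qed

text \<open>An ideal qubit has the identity as its single Kraus operator; its complement, the trace,
  has one outcome, of probability 1 whatever the input.\<close>

lemma kraus_system_qubit:
  "kraus_system 2 2 1 1 (\<lambda>X. X) (\<lambda>X. mat 1 1 (\<lambda>_. mtrace X))
     (\<lambda>_ _. 1) (\<lambda>_ r i. if r = i then 1 else 0) (\<lambda>i p. if i = p then 1 else 0) (\<lambda>_ _. 1)"
  by (auto simp: kraus_system_def matrix_unit_index numeral_2_eq_2 less_Suc_eq mtrace_def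
      matrix_unit_def outer_def unit_vec_def)

lemma tensor_pow_one: "tensor_pow k a (\<lambda>_ _. 1) n = (\<lambda>_ _. 1)"
  by (induction n) (simp_all add: tensor2_def fun_eq_iff)

subsection \<open>Channels with cq complement\<close>

text \<open>Cholesky decomposition: the induction step splits off the Schur complement of the last entry.\<close>

lemma psd_form_decomposition:
  fixes f :: "nat \<Rightarrow> nat \<Rightarrow> complex"
  assumes "\<And>v. 0 \<le> (\<Sum>p<d. \<Sum>q<d. cnj (v p) * f p q * v q)"
  shows "\<exists>L. \<forall>p<d. \<forall>q<d. f p q = (\<Sum>s<d. L s p * cnj (L s q))"
  using assms
proof (induction d arbitrary: f)
  case 0
  then show ?case by simp
next
  case (Suc d)
  \<comment> \<open>The form evaluated at \<open>x\<close> times the basis vector \<open>p\<close>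
    plus \<open>y\<close> times the basis vector \<open>q\<close>.\<close>
  have two: "0 \<le> cnj x * x * f p p + cnj x * y * f p q + cnj y * x * f q p + cnj y * y * f q q"
    if pq: "p < Suc d" "q < Suc d" "p \<noteq> q" for x y p q
  proof -
    let ?v = "\<lambda>i. (if i = p then x else 0) + (if i = q then y else 0)"
    have "(\<Sum>i<Suc d. \<Sum>j<Suc d. cnj (?v i) * f i j * ?v j) =
      (\<Sum>i<Suc d. cnj (?v i) * (f i p * x + f i q * y))"
    proof (rule sum.cong[OF refl])
      fix i
      have "(\<Sum>j<Suc d. cnj (?v i) * f i j * ?v j) =
        cnj (?v i) * (\<Sum>j<Suc d. (if j = p then f i j * x else 0) + (if j = q then f i j * y else 0))"
        unfolding sum_distrib_left by (intro sum.cong refl) (simp add: algebra_simps)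
      also have "\<dots> = cnj (?v i) * (f i p * x + f i q * y)"
        unfolding sum.distrib using pq by (simp only: sum.delta finite_lessThan lessThan_iff) simp
      finally show "(\<Sum>j<Suc d. cnj (?v i) * f i j * ?v j) = cnj (?v i) * (f i p * x + f i q * y)" .
    qed
    also have "\<dots> = (\<Sum>i<Suc d. (if i = p then cnj x * (f i p * x + f i q * y) else 0)
        + (if i = q then cnj y * (f i p * x + f i q * y) else 0))"
      by (intro sum.cong refl) (auto simp: algebra_simps)
    also have "\<dots> = cnj x * (f p p * x + f p q * y) + cnj y * (f q p * x + f q q * y)"
      unfolding sum.distrib using pq by (simp only: sum.delta finite_lessThan lessThan_iff) simp
    finally show ?thesis using Suc.prems[of ?v] by (simp add: algebra_simps)
  qed
  have diag: "0 \<le> f p p" if "p < Suc d" for p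
  proof -
    have "(\<Sum>i<Suc d. \<Sum>j<Suc d. cnj (if i = p then 1 else 0) * f i j * (if j = p then 1 else 0)) =
       (\<Sum>i<Suc d. \<Sum>j<Suc d. if j = p then (if i = p then f i j else 0) else 0)"
      by (intro sum.cong refl) auto
    also have "\<dots> = f p p"
      using that by (simp only: sum.delta finite_lessThan lessThan_iff) simp
    finally show ?thesis using Suc.prems[of "\<lambda>i. if i = p then 1 else 0"] by simp
  qed
  have herm: "f q p = cnj (f p q)" if pq: "p < Suc d" "q < Suc d" for p q
  proof (cases "p = q")
    case True
    then show ?thesis using diag[OF pq(1)] by (simp add: complex_eq_iff less_eq_complex_def)
  next
    case False
    have "Im (f p p) = 0" "Im (f q q) = 0"
      using diag pq by (auto simp: less_eq_complex_def)
    \<comment> \<open>Nonnegativity in the complex order includes realness: the vector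
      \<open>(1, 1)\<close> gives opposite imaginary parts of \<open>f p q\<close> and
      \<open>f q p\<close>, the vector \<open>(1, \<i>)\<close> equal real parts.\<close>
    with two[OF pq False, of 1 1] two[OF pq False, of 1 \<i>] show ?thesis
      by (simp add: complex_eq_iff less_eq_complex_def)
  qed
  define \<alpha> where "\<alpha> = Re (f d d)"
  have \<alpha>: "f d d = of_real \<alpha>" "0 \<le> \<alpha>"
    using diag[of d] by (simp_all add: \<alpha>_def complex_eq_iff less_eq_complex_def)
  have zero: "f p d = 0" if "\<alpha> = 0" "p < d" for p
  proof (rule ccontr)
    assume nz: "f p d \<noteq> 0"
    \<comment> \<open>Chosen so that the form takes the value -1 at the test vector used next;
      \<open>f d d = 0\<close> removes the term quadratic in \<open>r\<close>.\<close>
    define r where "r = (Re (f p p) + 1) / (2 * (cmod (f p d))\<^sup>2)"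
    have "0 \<le> cnj 1 * 1 * f p p + cnj 1 * (- of_real r * cnj (f p d)) * f p d
       + cnj (- of_real r * cnj (f p d)) * 1 * f d p"
      using two[of p d 1 "- of_real r * cnj (f p d)"] that \<alpha> by simp
    also have "\<dots> = f p p - of_real (2 * r) * (f p d * cnj (f p d))"
      using herm[of p d] that by (simp add: algebra_simps)
    also have "\<dots> = f p p - of_real (2 * r * (cmod (f p d))\<^sup>2)"
      by (simp only: of_real_mult complex_norm_square)
    finally have "2 * r * (cmod (f p d))\<^sup>2 \<le> Re (f p p)"
      by (simp add: less_eq_complex_def)
    moreover have "2 * r * (cmod (f p d))\<^sup>2 = Re (f p p) + 1"
      using nz by (simp add: r_def field_simps)
    ultimately show False by simp
  qed
  \<comment> \<open>If \<open>\<alpha> = 0\<close>, the correction is 0 by the convention for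
    division, in line with \<open>zero\<close>.\<close>
  define g where "g p q = f p q - f p d * f d q / of_real \<alpha>" for p q
  have "\<exists>L. \<forall>p<d. \<forall>q<d. g p q = (\<Sum>s<d. L s p * cnj (L s q))"
  proof (rule Suc.IH)
    fix v :: "nat \<Rightarrow> complex"
    define \<beta> where "\<beta> = (\<Sum>q<d. f d q * v q)"
    have \<beta>': "cnj \<beta> = (\<Sum>p<d. cnj (v p) * f p d)"
      unfolding \<beta>_def cnj_sum by (intro sum.cong refl) (simp add: herm[of d, symmetric] mult.commute)
    have \<beta>0: "\<beta> = 0" if "\<alpha> = 0"
      unfolding \<beta>_def using zero[OF that] herm[of _ d] by (intro sum.neutral) simp
    \<comment> \<open>For positive \<open>\<alpha>\<close> the minimiser of the form over the last
      coordinate, so that completing the square leaves the form of \<open>g\<close>.\<close>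
    define y where "y = - \<beta> / of_real \<alpha>"
    define u where "u i = (if i = d then y else v i)" for i
    have "(\<Sum>p<Suc d. \<Sum>q<Suc d. cnj (u p) * f p q * u q)
       = (\<Sum>p<d. \<Sum>q<d. cnj (v p) * f p q * v q) + (\<Sum>p<d. cnj (v p) * f p d) * y
         + cnj y * (\<Sum>q<d. f d q * v q) + cnj y * f d d * y"
      by (simp add: u_def sum.distrib sum_distrib_left sum_distrib_right mult.assoc)
    also have "\<dots> = (\<Sum>p<d. \<Sum>q<d. cnj (v p) * f p q * v q) + cnj \<beta> * y + cnj y * \<beta> + cnj y * f d d * y"
      by (simp only: \<beta>'[symmetric] \<beta>_def[symmetric])
    also have "\<dots> = (\<Sum>p<d. \<Sum>q<d. cnj (v p) * f p q * v q) - cnj \<beta> * \<beta> / of_real \<alpha>"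
      using \<beta>0 by (cases "\<alpha> = 0") (simp_all add: y_def \<alpha> field_simps)
    also have "\<dots> = (\<Sum>p<d. \<Sum>q<d. cnj (v p) * g p q * v q)"
      unfolding \<beta>' unfolding \<beta>_def g_def
      by (simp add: sum_product sum_divide_distrib sum_subtractf algebra_simps)
        (rule sum.swap)
    finally show "0 \<le> (\<Sum>p<d. \<Sum>q<d. cnj (v p) * g p q * v q)" using Suc.prems[of u] by simp
  qed
  then obtain L where L: "\<forall>p<d. \<forall>q<d. g p q = (\<Sum>s<d. L s p * cnj (L s q))" by blast
  \<comment> \<open>The new vector \<open>d\<close> carries the last column divided by
    \<open>sqrt \<alpha>\<close>; the vectors from the induction hypothesis are extended by
    0.\<close>
  define L' where "L' s p = (if s = d then f p d / of_real (sqrt \<alpha>) else if p = d then 0 else L s p)" for s p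
  have sq: "complex_of_real (sqrt \<alpha>) * of_real (sqrt \<alpha>) = of_real \<alpha>"
    using \<alpha>(2) by (metis of_real_mult real_sqrt_mult_self abs_of_nonneg)
  show ?case
  proof (intro exI[of _ L'] allI impI)
    fix p q assume pq: "p < Suc d" "q < Suc d"
    have "L' d p * cnj (L' d q) = f p d * f d q / of_real \<alpha>"
      using herm[of q d] pq sq by (simp add: L'_def)
    moreover have "(\<Sum>s<d. L' s p * cnj (L' s q)) = f p q - f p d * f d q / of_real \<alpha>"
    proof (cases "p = d \<or> q = d")
      case True
      have "f p q = f p d * f d q / of_real \<alpha>"
      proof (cases "\<alpha> = 0")
        case a0: True
        have "f p d = 0" if "p < Suc d" for p
          using zero[OF a0, of p] \<alpha>(1) a0 that by (cases "p = d") auto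
        then show ?thesis using True pq herm[of q d] herm[of p d] \<alpha> a0 by auto
      qed (use True \<alpha> in auto)
      moreover have "(\<Sum>s<d. L' s p * cnj (L' s q)) = 0"
        using True by (intro sum.neutral) (auto simp: L'_def)
      ultimately show ?thesis by simp
    next
      case False
      then have "(\<Sum>s<d. L' s p * cnj (L' s q)) = g p q"
        using L pq by (simp add: L'_def)
      then show ?thesis by (simp add: g_def)
    qed
    ultimately show "f p q = (\<Sum>s<Suc d. L' s p * cnj (L' s q))" by simp
  qed
qed

lemma psd_decomposition:
  assumes "psd d X"
  shows "\<exists>L. \<forall>p<d. \<forall>q<d. X $$ (p, q) = (\<Sum>s<d. L s p * cnj (L s q))"
proof (rule psd_form_decomposition)
  fix v :: "nat \<Rightarrow> complex"
  have X: "X \<in> carrier_mat d d" and pos: "\<And>v. v \<in> carrier_vec d \<Longrightarrow> 0 \<le> (X *\<^sub>v v) \<bullet>c v"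
    using assms by (auto simp: psd_def)
  have "(X *\<^sub>v vec d v) \<bullet>c vec d v = (\<Sum>p<d. \<Sum>q<d. cnj (v p) * X $$ (p, q) * v q)"
    using X by (auto simp: scalar_prod_def lessThan_atLeast0 sum_distrib_right intro!: sum.cong)
  then show "0 \<le> (\<Sum>p<d. \<Sum>q<d. cnj (v p) * X $$ (p, q) * v q)"
    using pos[of "vec d v"] by simp
qed

section \<open>From the Stinespring isometry to Kraus operators\<close>

lemma mat_adjoint_index:
  fixes A :: "complex mat"
  assumes "A \<in> carrier_mat n m" "i < m" "j < n"
  shows "mat_adjoint A $$ (i, j) = cnj (A $$ (j, i))"
  using assms by (auto simp: mat_adjoint_def mat_of_rows_def)

lemma isometry_conjugation_index:
  fixes V X :: "complex mat"
  assumes V: "V \<in> carrier_mat n a" and X: "X \<in> carrier_mat a a" and z: "z < n" "z' < n"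
  shows "(V * X * mat_adjoint V) $$ (z, z') =
    (\<Sum>p<a. \<Sum>q<a. V $$ (z, p) * X $$ (p, q) * cnj (V $$ (z', q)))"
proof -
  have adj: "mat_adjoint V \<in> carrier_mat a n"
    using V by (auto simp: mat_adjoint_def mat_of_rows_def)
  have "(V * X * mat_adjoint V) $$ (z, z') = (\<Sum>q<a. (V * X) $$ (z, q) * mat_adjoint V $$ (q, z'))"
    using V X z adj by (simp add: scalar_prod_def lessThan_atLeast0 del: assoc_mult_mat)
  also have "\<dots> = (\<Sum>q<a. (\<Sum>p<a. V $$ (z, p) * X $$ (p, q)) * cnj (V $$ (z', q)))"
    using V X z by (intro sum.cong refl) (simp add: scalar_prod_def lessThan_atLeast0 mat_adjoint_index)
  also have "\<dots> = (\<Sum>p<a. \<Sum>q<a. V $$ (z, p) * X $$ (p, q) * cnj (V $$ (z', q)))"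
    unfolding sum_distrib_right by (rule sum.swap)
  finally show ?thesis .
qed

text \<open>Orthonormality gives a square matrix a right inverse; it is also a left inverse, which
  is the completeness relation.\<close>

lemma orthonormal_basis_complete:
  assumes "orthonormal_basis d e" "p < d" "q < d"
  shows "(\<Sum>i<d. e i $ p * cnj (e i $ q)) = (if p = q then 1 else 0)"
proof -
  let ?A = "mat d d (\<lambda>(i, p). e i $ p)" and ?B = "mat d d (\<lambda>(p, i). cnj (e i $ p))"
  have e: "\<And>i. i < d \<Longrightarrow> e i \<in> carrier_vec d"
    and on: "\<And>i j. i < d \<Longrightarrow> j < d \<Longrightarrow> e i \<bullet>c e j = (if i = j then 1 else 0)"
    using assms(1) by (auto simp: orthonormal_basis_def)
  have "?A * ?B = 1\<^sub>m d"
  proof (rule eq_matI)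
    fix i j assume ij: "i < dim_row (1\<^sub>m d)" "j < dim_col (1\<^sub>m d)"
    then show "(?A * ?B) $$ (i, j) = 1\<^sub>m d $$ (i, j)"
      using on[of i j] e[of i] e[of j] by (simp add: scalar_prod_def)
  qed auto
  then have "?B * ?A = 1\<^sub>m d" by (rule mat_mult_left_right_inverse[rotated 2]) auto
  then have "(?B * ?A) $$ (q, p) = 1\<^sub>m d $$ (q, p)" by simp
  then have "(\<Sum>i<d. cnj (e i $ q) * e i $ p) = (if q = p then 1 else 0)"
    using assms by (simp add: scalar_prod_def lessThan_atLeast0)
  moreover have "(\<Sum>i<d. cnj (e i $ q) * e i $ p) = (\<Sum>i<d. e i $ p * cnj (e i $ q))"
    by (intro sum.cong refl mult.commute)
  ultimately show ?thesis by auto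
qed

text \<open>With \<open>v\<close> and \<open>v'\<close> read as vectors of
  \<open>B \<otimes> E\<close>, tracing out \<open>B\<close> and testing against
  \<open>\<phi>\<close> equals projecting \<open>E\<close> onto \<open>\<phi>\<close> first and
  taking the inner product in \<open>B\<close>.\<close>

lemma complementary_output_form:
  fixes v v' \<phi> :: "nat \<Rightarrow> complex"
  shows "(\<Sum>x<e. \<Sum>y<e. (\<Sum>r<b. v (r * e + x) * cnj (v' (r * e + y))) * (\<phi> y * cnj (\<phi> x))) =
    (\<Sum>r<b. (\<Sum>x<e. cnj (\<phi> x) * v (r * e + x)) * cnj (\<Sum>y<e. cnj (\<phi> y) * v' (r * e + y)))"
proof -
  have "(\<Sum>r<b. (\<Sum>x<e. cnj (\<phi> x) * v (r * e + x)) * cnj (\<Sum>y<e. cnj (\<phi> y) * v' (r * e + y)))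
     = (\<Sum>r<b. \<Sum>x<e. \<Sum>y<e. v (r * e + x) * cnj (v' (r * e + y)) * (\<phi> y * cnj (\<phi> x)))"
    unfolding cnj_sum sum_product by (simp add: mult_ac)
  also have "\<dots> = (\<Sum>x<e. \<Sum>r<b. \<Sum>y<e. v (r * e + x) * cnj (v' (r * e + y)) * (\<phi> y * cnj (\<phi> x)))"
    by (rule sum.swap)
  also have "\<dots> = (\<Sum>x<e. \<Sum>y<e. \<Sum>r<b. v (r * e + x) * cnj (v' (r * e + y)) * (\<phi> y * cnj (\<phi> x)))"
    by (intro sum.cong refl sum.swap)
  finally show ?thesis by (simp add: sum_distrib_right)
qed

text \<open>Inserting the resolution of the identity by the \<open>\<phi> t\<close> on
  \<open>E\<close> turns the partial trace over \<open>E\<close> into a Kraus sum.\<close>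

lemma kraus_output_form:
  fixes u u' :: "nat \<Rightarrow> complex" and \<phi> :: "nat \<Rightarrow> nat \<Rightarrow> complex"
  assumes "\<And>x y. x < e \<Longrightarrow> y < e \<Longrightarrow> (\<Sum>t<k. \<phi> t x * cnj (\<phi> t y)) = (if x = y then 1 else 0)"
  shows "(\<Sum>t<k. (\<Sum>x<e. cnj (\<phi> t x) * u x) * cnj (\<Sum>y<e. cnj (\<phi> t y) * u' y)) = (\<Sum>x<e. u x * cnj (u' x))"
proof -
  have "(\<Sum>t<k. (\<Sum>x<e. cnj (\<phi> t x) * u x) * cnj (\<Sum>y<e. cnj (\<phi> t y) * u' y))
     = (\<Sum>t<k. \<Sum>x<e. \<Sum>y<e. u x * cnj (u' y) * (\<phi> t y * cnj (\<phi> t x)))"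
    unfolding cnj_sum sum_product by (simp add: mult_ac)
  also have "\<dots> = (\<Sum>x<e. \<Sum>t<k. \<Sum>y<e. u x * cnj (u' y) * (\<phi> t y * cnj (\<phi> t x)))"
    by (rule sum.swap)
  also have "\<dots> = (\<Sum>x<e. \<Sum>y<e. \<Sum>t<k. u x * cnj (u' y) * (\<phi> t y * cnj (\<phi> t x)))"
    by (intro sum.cong refl sum.swap)
  also have "\<dots> = (\<Sum>x<e. \<Sum>y<e. if x = y then u x * cnj (u' y) else 0)"
    unfolding sum_distrib_left[symmetric] by (intro sum.cong refl) (simp add: assms)
  finally show ?thesis by simp
qed

text \<open>For fixed \<open>t\<close> the Gram matrix of the columns of \<open>C t\<close> consists
  of the expectations at \<open>\<phi> t\<close> of \<open>Nc\<close> applied to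
  \<open>|i><j|\<close>. A cq complement kills these for distinct \<open>i\<close> and
  \<open>j\<close>, hence orthogonality, and the diagonal holds Eve's outcome probabilities.\<close>

lemma kraus_system_cq:
  assumes compl: "complementary_channel dA dB dE N Nc" and cq: "cq_channel dA dE Nc e \<rho>"
    and res: "\<And>x y. x < dE \<Longrightarrow> y < dE \<Longrightarrow> (\<Sum>t<k. \<phi> t x * cnj (\<phi> t y)) = (if x = y then 1 else 0)"
  shows "\<exists>C. kraus_system dA dB dE k N Nc \<phi> C (\<lambda>i p. e i $ p)
    (\<lambda>t i. Re (\<Sum>x<dE. \<Sum>y<dE. \<rho> i $$ (x, y) * (\<phi> t y * cnj (\<phi> t x))))"
proof -
  obtain V where V: "V \<in> carrier_mat (dB * dE) dA"
    and N: "\<And>X. X \<in> carrier_mat dA dA \<Longrightarrow> N X = ptrace_snd dB dE (V * X * mat_adjoint V)"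
    and Nc: "\<And>X. X \<in> carrier_mat dA dA \<Longrightarrow> Nc X = ptrace_fst dB dE (V * X * mat_adjoint V)"
    using compl unfolding complementary_channel_def by blast
  have on: "orthonormal_basis dA e" and dens: "\<And>i. i < dA \<Longrightarrow> density_operator dE (\<rho> i)"
    and Nce: "\<And>i j. i < dA \<Longrightarrow> j < dA \<Longrightarrow> Nc (outer (e i) (e j)) = (if i = j then \<rho> i else 0\<^sub>m dE dE)"
    using cq unfolding cq_channel_def by auto
  have ei: "dim_vec (e i) = dA" if "i < dA" for i
    using on that by (auto simp: orthonormal_basis_def)
  have comp: "(\<Sum>i<dA. e i $ p * cnj (e i $ q)) = (if p = q then 1 else 0)" if "p < dA" "q < dA" for p q
    using orthonormal_basis_complete[OF on that] .
  have bound: "r * dE + x < dB * dE" if "r < dB" "x < dE" for r x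
  proof -
    have "r * dE + x < Suc r * dE" using that by simp
    also have "\<dots> \<le> dB * dE" using that by (intro mult_right_mono) auto
    finally show ?thesis .
  qed
  \<comment> \<open>\<open>v i\<close> is the image of \<open>e i\<close> under the isometry
    \<open>V\<close>; \<open>C t\<close> projects its environment part onto
    \<open>\<phi> t\<close>.\<close>
  define v where "v i z = (\<Sum>p<dA. V $$ (z, p) * e i $ p)" for i z
  define C where "C t r i = (\<Sum>x<dE. cnj (\<phi> t x) * v i (r * dE + x))" for t r i
  define w where "w t i = (\<Sum>x<dE. \<Sum>y<dE. \<rho> i $$ (x, y) * (\<phi> t y * cnj (\<phi> t x)))" for t i
  have mu: "matrix_unit dA p q \<in> carrier_mat dA dA" for p q
    by (simp add: matrix_unit_def outer_def)
  have conj_mu: "(V * matrix_unit dA p q * mat_adjoint V) $$ (z, z') = V $$ (z, p) * cnj (V $$ (z', q))"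
    if "p < dA" "q < dA" "z < dB * dE" "z' < dB * dE" for p q z z'
  proof -
    have "(V * matrix_unit dA p q * mat_adjoint V) $$ (z, z') =
      (\<Sum>p'<dA. \<Sum>q'<dA. V $$ (z, p') * matrix_unit dA p q $$ (p', q') * cnj (V $$ (z', q')))"
      by (rule isometry_conjugation_index[OF V mu that(3,4)])
    also have "\<dots> = (\<Sum>p'<dA. \<Sum>q'<dA. if q' = q then (if p' = p then V $$ (z, p') * cnj (V $$ (z', q')) else 0) else 0)"
      by (intro sum.cong refl) (auto simp: matrix_unit_index)
    also have "\<dots> = V $$ (z, p) * cnj (V $$ (z', q))"
      using that by (simp only: sum.delta finite_lessThan lessThan_iff) simp
    finally show ?thesis .
  qed
  have outer_carrier: "outer (e i) (e j) \<in> carrier_mat dA dA" if "i < dA" "j < dA" for i j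
    using ei that by (simp add: outer_def)
  have conj_outer: "(V * outer (e i) (e j) * mat_adjoint V) $$ (z, z') = v i z * cnj (v j z')"
    if "i < dA" "j < dA" "z < dB * dE" "z' < dB * dE" for i j z z'
  proof -
    show ?thesis
      unfolding isometry_conjugation_index[OF V outer_carrier[OF that(1,2)] that(3,4)] v_def cnj_sum sum_product
      using ei that by (intro sum.cong refl) (simp add: outer_def mult_ac)
  qed
  \<comment> \<open>By completeness of the basis, undoing the change of basis recovers the Kraus
    operator in standard coordinates.\<close>
  have kraus: "(\<Sum>i<dA. C t r i * cnj (e i $ p)) = (\<Sum>x<dE. cnj (\<phi> t x) * V $$ (r * dE + x, p))"
    if p: "p < dA" for t r p
  proof -
    have "(\<Sum>i<dA. v i z * cnj (e i $ p)) = V $$ (z, p)" for z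
    proof -
      have "(\<Sum>i<dA. v i z * cnj (e i $ p)) = (\<Sum>i<dA. \<Sum>q<dA. V $$ (z, q) * (e i $ q * cnj (e i $ p)))"
        by (simp add: v_def sum_distrib_right mult.assoc)
      also have "\<dots> = (\<Sum>q<dA. V $$ (z, q) * (\<Sum>i<dA. e i $ q * cnj (e i $ p)))"
        unfolding sum_distrib_left by (rule sum.swap)
      also have "\<dots> = (\<Sum>q<dA. if q = p then V $$ (z, q) else 0)"
        using p by (intro sum.cong refl) (simp add: comp)
      finally show ?thesis using p by simp
    qed
    moreover have "(\<Sum>i<dA. C t r i * cnj (e i $ p)) =
        (\<Sum>x<dE. cnj (\<phi> t x) * (\<Sum>i<dA. v i (r * dE + x) * cnj (e i $ p)))"
      unfolding C_def sum_distrib_left sum_distrib_right by (subst sum.swap) (simp add: mult.assoc)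
    ultimately show ?thesis by simp
  qed
  have orthC: "(\<Sum>r<dB. C t r i * cnj (C t r j)) = (if i = j then of_real (Re (w t i)) else 0)"
    if ij: "i < dA" "j < dA" for t i j
  proof -
    have "(\<Sum>r<dB. C t r i * cnj (C t r j)) =
       (\<Sum>x<dE. \<Sum>y<dE. Nc (outer (e i) (e j)) $$ (x, y) * (\<phi> t y * cnj (\<phi> t x)))"
      unfolding C_def complementary_output_form[symmetric]
      using ei ij by (intro sum.cong refl) (simp add: Nc outer_carrier ptrace_fst_def conj_outer bound)
    also have "\<dots> = (if i = j then w t i else 0)"
      using ij by (simp add: Nce w_def)
    finally have *: "(\<Sum>r<dB. C t r i * cnj (C t r j)) = (if i = j then w t i else 0)" .
    \<comment> \<open>Equality with a squared norm shows that \<open>w t i\<close> is real, so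
      taking \<open>Re\<close> loses nothing.\<close>
    moreover have "w t i = of_real (Re (w t i))" if "i = j"
    proof -
      have "w t i = of_real (\<Sum>r<dB. (cmod (C t r i))\<^sup>2)"
        using * that by (simp only: of_real_sum complex_norm_square) simp
      then show ?thesis by (metis Re_complex_of_real)
    qed
    ultimately show ?thesis by simp
  qed
  have K1: "N (matrix_unit dA p q) $$ (r, s) =
      (\<Sum>t<k. (\<Sum>i<dA. C t r i * cnj (e i $ p)) * cnj (\<Sum>i<dA. C t s i * cnj (e i $ q)))"
    if *: "p < dA" "q < dA" "r < dB" "s < dB" for p q r s
  proof -
    have "N (matrix_unit dA p q) $$ (r, s) = (\<Sum>x<dE. V $$ (r * dE + x, p) * cnj (V $$ (s * dE + x, q)))"
      using * mu by (simp add: N ptrace_snd_def conj_mu bound)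
    also have "\<dots> = (\<Sum>t<k. (\<Sum>x<dE. cnj (\<phi> t x) * V $$ (r * dE + x, p)) *
        cnj (\<Sum>y<dE. cnj (\<phi> t y) * V $$ (s * dE + y, q)))"
      by (rule kraus_output_form[OF res, symmetric])
    finally show ?thesis by (simp only: kraus[OF *(1)] kraus[OF *(2)])
  qed
  have K2: "(\<Sum>x<dE. \<Sum>y<dE. Nc (matrix_unit dA p q) $$ (x, y) * (\<phi> t y * cnj (\<phi> t x))) =
      (\<Sum>i<dA. complex_of_real (Re (w t i)) * (cnj (e i $ p) * e i $ q))"
    if *: "p < dA" "q < dA" for p q t
  proof -
    have "(\<Sum>x<dE. \<Sum>y<dE. Nc (matrix_unit dA p q) $$ (x, y) * (\<phi> t y * cnj (\<phi> t x))) =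
       (\<Sum>x<dE. \<Sum>y<dE. (\<Sum>r<dB. V $$ (r * dE + x, p) * cnj (V $$ (r * dE + y, q))) * (\<phi> t y * cnj (\<phi> t x)))"
      using * mu by (intro sum.cong refl) (simp add: Nc ptrace_fst_def conj_mu bound)
    also have "\<dots> = (\<Sum>r<dB. (\<Sum>x<dE. cnj (\<phi> t x) * V $$ (r * dE + x, p)) *
        cnj (\<Sum>y<dE. cnj (\<phi> t y) * V $$ (r * dE + y, q)))"
      by (rule complementary_output_form)
    also have "\<dots> = (\<Sum>r<dB. (\<Sum>i<dA. C t r i * cnj (e i $ p)) * cnj (\<Sum>i<dA. C t r i * cnj (e i $ q)))"
      by (simp only: kraus[OF *(1)] kraus[OF *(2)])
    also have "\<dots> = (\<Sum>r<dB. \<Sum>i<dA. \<Sum>j<dA. (cnj (e i $ p) * e j $ q) * (C t r i * cnj (C t r j)))"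
      unfolding cnj_sum sum_product by (simp add: mult_ac)
    also have "\<dots> = (\<Sum>i<dA. \<Sum>r<dB. \<Sum>j<dA. (cnj (e i $ p) * e j $ q) * (C t r i * cnj (C t r j)))"
      by (rule sum.swap)
    also have "\<dots> = (\<Sum>i<dA. \<Sum>j<dA. \<Sum>r<dB. (cnj (e i $ p) * e j $ q) * (C t r i * cnj (C t r j)))"
      by (intro sum.cong refl sum.swap)
    also have "\<dots> = (\<Sum>i<dA. \<Sum>j<dA. if i = j then (cnj (e i $ p) * e j $ q) * of_real (Re (w t i)) else 0)"
      unfolding sum_distrib_left[symmetric] by (intro sum.cong refl) (simp add: orthC)
    finally show ?thesis by (simp add: mult.commute)
  qed
  have K6: "(\<Sum>t<k. Re (w t i)) = 1" if i: "i < dA" for i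
  proof -
    have "(\<Sum>t<k. w t i) = (\<Sum>x<dE. \<Sum>t<k. \<Sum>y<dE. \<rho> i $$ (x, y) * (\<phi> t y * cnj (\<phi> t x)))"
      unfolding w_def by (rule sum.swap)
    also have "\<dots> = (\<Sum>x<dE. \<Sum>y<dE. \<Sum>t<k. \<rho> i $$ (x, y) * (\<phi> t y * cnj (\<phi> t x)))"
      by (intro sum.cong refl sum.swap)
    also have "\<dots> = (\<Sum>x<dE. \<Sum>y<dE. if x = y then \<rho> i $$ (x, y) else 0)"
      unfolding sum_distrib_left[symmetric] by (intro sum.cong refl) (simp add: res)
    also have "\<dots> = mtrace (\<rho> i)"
      using dens[OF i] by (auto simp: mtrace_def density_operator_def psd_def)
    finally have "(\<Sum>t<k. w t i) = 1" using dens[OF i] by (simp add: density_operator_def)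
    then have "Re (\<Sum>t<k. w t i) = 1" by simp
    then show ?thesis by simp
  qed
  have "kraus_system dA dB dE k N Nc \<phi> C (\<lambda>i p. e i $ p) (\<lambda>t i. Re (w t i))"
    unfolding kraus_system_def by (intro conjI allI impI; rule K1 K2 orthC comp res K6; assumption)
  then show ?thesis unfolding w_def by blast
qed

text \<open>Each element is split into \<open>d\<close> terms of rank at most one; the refined
  outcome \<open>t * d + l\<close> remembers the original one as its quotient by
  \<open>d\<close>.\<close>

lemma povm_rank_one_refinement:
  assumes "povm d k Q"
  shows "\<exists>\<phi>. (\<forall>t<k. \<forall>x<d. \<forall>y<d. Q t $$ (x, y) = (\<Sum>l<d. \<phi> (t * d + l) x * cnj (\<phi> (t * d + l) y))) \<and>
    (\<forall>x<d. \<forall>y<d. (\<Sum>j<k * d. \<phi> j x * cnj (\<phi> j y)) = (if x = y then 1 else 0))"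
proof -
  have "\<forall>t\<in>{..<k}. \<exists>L. \<forall>x<d. \<forall>y<d. Q t $$ (x, y) = (\<Sum>l<d. L l x * cnj (L l y))"
    using assms by (auto simp: povm_def intro: psd_decomposition)
  then obtain L where L: "\<forall>t\<in>{..<k}. \<forall>x<d. \<forall>y<d. Q t $$ (x, y) = (\<Sum>l<d. L t l x * cnj (L t l y))"
    by (auto simp: bchoice_iff)
  define \<phi> where "\<phi> j = L (j div d) (j mod d)" for j
  have Q: "Q t $$ (x, y) = (\<Sum>l<d. \<phi> (t * d + l) x * cnj (\<phi> (t * d + l) y))" if "t < k" "x < d" "y < d" for t x y
    using L that by (simp add: \<phi>_def)
  have "(\<Sum>j<k * d. \<phi> j x * cnj (\<phi> j y)) = (if x = y then 1 else 0)" if xy: "x < d" "y < d" for x y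
  proof -
    have "(\<Sum>j<k * d. \<phi> j x * cnj (\<phi> j y)) = (\<Sum>t<k. Q t $$ (x, y))"
      unfolding sum_lessThan_mult using xy by (intro sum.cong refl) (simp add: Q)
    also have "\<dots> = mat d d (\<lambda>rc. \<Sum>j<k. Q j $$ rc) $$ (x, y)" using xy by simp
    also have "\<dots> = (if x = y then 1 else 0)" using assms xy by (simp add: povm_def)
    finally show ?thesis .
  qed
  with Q show ?thesis by blast
qed

subsection \<open>Conditional entropy of product measurements\<close>

text \<open>\<open>W t i\<close> is a guess for the posterior probability of the letter
  \<open>i\<close> given the outcome \<open>t\<close>, and the last conclusion bounds its expected
  logarithmic loss. The guess is built from the coarse outcome of a measurement with entropy below
  \<open>h\<close>, so the refinement leaves its loss unchanged. It is strictly positive, so the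
  logarithms of its tensor powers are additive.\<close>

lemma good_measurement:
  assumes dA: "0 < dA" and compl: "complementary_channel dA dB dE N Nc" and cq: "cq_channel dA dE Nc e \<rho>"
    and p: "prob_vector dA p" and h: "acc_cond_entropy dA dE p \<rho> < ereal h"
  shows "\<exists>k \<phi> C w W. kraus_system dA dB dE k N Nc \<phi> C (\<lambda>i p. e i $ p) w \<and>
    (\<forall>t<k. \<forall>i<dA. 0 < W t i) \<and> (\<forall>t<k. (\<Sum>i<dA. W t i) \<le> 1) \<and>
    (\<Sum>i<dA. p i * (\<Sum>t<k. w t i * - log 2 (W t i))) \<le> h"
proof -
  obtain k Q where Q: "povm dE k Q"
    and ent: "shannon_cond_entropy dA k (\<lambda>(i, j). p i * Re (mtrace (\<rho> i * Q j))) < h"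
    using h unfolding acc_cond_entropy_def INF_less_iff by auto
  obtain \<phi> where Q\<phi>: "\<And>t x y. t < k \<Longrightarrow> x < dE \<Longrightarrow> y < dE \<Longrightarrow>
      Q t $$ (x, y) = (\<Sum>l<dE. \<phi> (t * dE + l) x * cnj (\<phi> (t * dE + l) y))"
    and res: "\<And>x y. x < dE \<Longrightarrow> y < dE \<Longrightarrow> (\<Sum>j<k * dE. \<phi> j x * cnj (\<phi> j y)) = (if x = y then 1 else 0)"
    using povm_rank_one_refinement[OF Q] by blast
  define w where "w t i = Re (\<Sum>x<dE. \<Sum>y<dE. \<rho> i $$ (x, y) * (\<phi> t y * cnj (\<phi> t x)))" for t i
  obtain C where K: "kraus_system dA dB dE (k * dE) N Nc \<phi> C (\<lambda>i p. e i $ p) w"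
    using kraus_system_cq[OF compl cq res] unfolding w_def by blast
  note w0 = kraus_system_nonneg[OF K]
  have w1: "(\<Sum>t<k * dE. w t i) = 1" if "i < dA" for i
    using K that by (simp add: kraus_system_def)
  have p0: "0 \<le> p i" if "i < dA" for i using p that by (simp add: prob_vector_def)
  define u where "u i j = Re (mtrace (\<rho> i * Q j))" for i j
  have uw: "u i j = (\<Sum>l<dE. w (j * dE + l) i)" if i: "i < dA" and j: "j < k" for i j
  proof -
    have \<rho>: "\<rho> i \<in> carrier_mat dE dE"
      using cq i by (auto simp: cq_channel_def density_operator_def psd_def)
    have Qj: "Q j \<in> carrier_mat dE dE" using Q j by (auto simp: povm_def psd_def)
    have "mtrace (\<rho> i * Q j) = (\<Sum>x<dE. \<Sum>y<dE. \<rho> i $$ (x, y) * Q j $$ (y, x))"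
      using \<rho> Qj by (simp add: mtrace_def scalar_prod_def lessThan_atLeast0)
    also have "\<dots> = (\<Sum>x<dE. \<Sum>y<dE. \<Sum>l<dE. \<rho> i $$ (x, y) * (\<phi> (j * dE + l) y * cnj (\<phi> (j * dE + l) x)))"
      using j by (intro sum.cong refl) (simp add: Q\<phi> sum_distrib_left)
    also have "\<dots> = (\<Sum>x<dE. \<Sum>l<dE. \<Sum>y<dE. \<rho> i $$ (x, y) * (\<phi> (j * dE + l) y * cnj (\<phi> (j * dE + l) x)))"
      by (intro sum.cong refl sum.swap)
    also have "\<dots> = (\<Sum>l<dE. \<Sum>x<dE. \<Sum>y<dE. \<rho> i $$ (x, y) * (\<phi> (j * dE + l) y * cnj (\<phi> (j * dE + l) x)))"
      by (rule sum.swap)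
    finally show ?thesis unfolding u_def w_def by simp
  qed
  have less: "j * dE + l < k * dE" if "j < k" "l < dE" for j l
  proof -
    have "j * dE + l < Suc j * dE" using that by simp
    also have "\<dots> \<le> k * dE" using that by (intro mult_right_mono) auto
    finally show ?thesis .
  qed
  have u0: "0 \<le> u i j" if "i < dA" "j < k" for i j
    unfolding uw[OF that] using w0 less that by (intro sum_nonneg) auto
  have u1: "(\<Sum>j<k. u i j) = 1" if "i < dA" for i
    using w1[OF that] that by (simp add: sum_lessThan_mult uw)
  \<comment> \<open>The true posterior, set to 0 by the convention for division at outcomes of
    probability 0; its sum over letters is 1 or 0.\<close>
  define W0 where "W0 j i = p i * u i j / (\<Sum>i'<dA. p i' * u i' j)" for j i
  define H where "H = (\<Sum>i<dA. \<Sum>j<k. p i * u i j * - log 2 (W0 j i))"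
  have H: "H < h"
  proof -
    have "(\<Sum>i<dA. \<Sum>j<k. p i * u i j) = 1"
      using p by (simp add: sum_distrib_left[symmetric] u1 prob_vector_def)
    then have "shannon_cond_entropy dA k (\<lambda>(i, j). p i * u i j) = H"
      by (subst shannon_cond_entropy_eq) (auto simp: p0 u0 H_def W0_def sum_negf)
    then show ?thesis using ent unfolding u_def by simp
  qed
  \<comment> \<open>mixing \<open>W0\<close> with the uniform distribution makes it positive and costs at most \<open>h - H\<close>\<close>
  define s where "s = 1 - 2 powr (- (h - H))"
  have s: "0 < s" "s < 1"
    using H by (simp_all add: s_def powr_less_one)
  have logs: "log 2 (1 - s) = - (h - H)" by (simp add: s_def)
  define W where "W t i = (1 - s) * W0 (t div dE) i + s / real dA" for t i
  have W00: "0 \<le> W0 j i" if "i < dA" "j < k" for i j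
    unfolding W0_def using p0 u0 that by (intro divide_nonneg_nonneg sum_nonneg mult_nonneg_nonneg) auto
  have Wpos: "0 < W t i" if "t < k * dE" "i < dA" for t i
    unfolding W_def using W00[of i "t div dE"] s dA that div_mod_less(1)[of t k dE]
    by (intro add_nonneg_pos mult_nonneg_nonneg divide_pos_pos) auto
  have Wsum: "(\<Sum>i<dA. W t i) \<le> 1" for t
  proof -
    have "(\<Sum>i<dA. W0 j i) \<le> 1" for j
      unfolding W0_def sum_divide_distrib[symmetric] by simp
    then have "(1 - s) * (\<Sum>i<dA. W0 (t div dE) i) \<le> (1 - s) * 1"
      using s by (intro mult_left_mono) auto
    then show ?thesis using dA by (simp add: W_def sum.distrib sum_distrib_left)
  qed
  have "(\<Sum>i<dA. p i * (\<Sum>t<k * dE. w t i * - log 2 (W t i))) =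
      (\<Sum>i<dA. \<Sum>j<k. p i * u i j * - log 2 ((1 - s) * W0 j i + s / real dA))"
  proof (rule sum.cong[OF refl])
    fix i assume i: "i \<in> {..<dA}"
    have "(\<Sum>t<k * dE. w t i * - log 2 (W t i)) = (\<Sum>j<k. u i j * - log 2 ((1 - s) * W0 j i + s / real dA))"
      unfolding sum_lessThan_mult W_def using i
      by (intro sum.cong refl) (simp add: uw sum_distrib_right sum_negf)
    then show "p i * (\<Sum>t<k * dE. w t i * - log 2 (W t i)) =
      (\<Sum>j<k. p i * u i j * - log 2 ((1 - s) * W0 j i + s / real dA))"
      by (simp add: sum_distrib_left mult.assoc)
  qed
  also have "\<dots> \<le> (\<Sum>i<dA. \<Sum>j<k. p i * u i j * - log 2 (W0 j i) + p i * u i j * (h - H))"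
  proof (intro sum_mono)
    fix i j assume "i \<in> {..<dA}" "j \<in> {..<k}"
    then have ij: "i < dA" "j < k" by auto
    show "p i * u i j * - log 2 ((1 - s) * W0 j i + s / real dA)
        \<le> p i * u i j * - log 2 (W0 j i) + p i * u i j * (h - H)"
    proof (cases "p i * u i j = 0")
      case False
      then have pos: "0 < p i * u i j" using p0 u0 ij by (simp add: less_le)
      have "p i * u i j \<le> (\<Sum>i'<dA. p i' * u i' j)"
        by (rule member_le_sum) (use ij p0 u0 in auto)
      then have W0: "0 < W0 j i" unfolding W0_def using pos by simp
      have "log 2 (W0 j i) - (h - H) = log 2 ((1 - s) * W0 j i)"
        using W0 s by (simp add: log_mult logs)
      also have "\<dots> \<le> log 2 ((1 - s) * W0 j i + s / real dA)"
        using W0 s dA by (subst log_le_cancel_iff) (auto intro!: add_pos_pos)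
      finally have "- log 2 ((1 - s) * W0 j i + s / real dA) \<le> - log 2 (W0 j i) + (h - H)" by simp
      from mult_left_mono[OF this less_imp_le[OF pos]] show ?thesis by (simp add: algebra_simps)
    qed auto
  qed
  also have "\<dots> = H + (\<Sum>i<dA. p i * (\<Sum>j<k. u i j)) * (h - H)"
    unfolding sum.distrib H_def[symmetric] by (simp add: sum_distrib_right sum_distrib_left mult.assoc)
  also have "\<dots> = h" using p by (simp add: u1 prob_vector_def)
  finally show ?thesis using K Wpos Wsum by blast
qed

section \<open>Letter sums of words encoded as \<open>n\<close> base-\<open>a\<close> digits, and
  product weights\<close>

primrec letter_sum :: "nat \<Rightarrow> (nat \<Rightarrow> real) \<Rightarrow> nat \<Rightarrow> nat \<Rightarrow> real" where
  "letter_sum a f 0 i = 0"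
| "letter_sum a f (Suc n) i = f (i div a ^ n) + letter_sum a f n (i mod a ^ n)"

lemma letter_sum_nonneg:
  assumes "\<And>i. i < a \<Longrightarrow> 0 \<le> f i" "i < a ^ n"
  shows "0 \<le> letter_sum a f n i"
  using assms(2)
proof (induction n arbitrary: i)
  case (Suc n)
  then have "i < a * a ^ n" by simp
  from div_mod_less[OF this] show ?case using Suc.IH assms(1) by (simp add: add_nonneg_nonneg)
qed simp

text \<open>A letter sum depends on the word only through its letter counts, the sums of indicators.
  This reduces averages over input words to the averaged letter distribution.\<close>

lemma letter_sum_indicator:
  assumes "i < a ^ n"
  shows "letter_sum a f n i = (\<Sum>j<a. f j * letter_sum a (\<lambda>x. of_bool (x = j)) n i)"
  using assms
proof (induction n arbitrary: i)
  case (Suc n)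
  then have "i < a * a ^ n" by simp
  note dm = div_mod_less[OF this]
  have "(\<Sum>j<a. f j * of_bool (i div a ^ n = j)) = (\<Sum>j<a. if j = i div a ^ n then f j else 0)"
    by (intro sum.cong refl) auto
  also have "\<dots> = f (i div a ^ n)" using dm by simp
  finally show ?case
    using Suc.IH[OF dm(2)] by (simp add: distrib_left sum.distrib)
qed simp

lemma letter_sum_one: "letter_sum a (\<lambda>_. 1) n i = real n"
  by (induction n arbitrary: i) auto

lemma tensor_pow_pos:
  fixes W :: "nat \<Rightarrow> nat \<Rightarrow> real"
  assumes "\<And>t i. t < k \<Longrightarrow> i < a \<Longrightarrow> 0 < W t i" "t < k ^ n" "i < a ^ n"
  shows "0 < tensor_pow k a W n t i"
  using assms(2,3)
proof (induction n arbitrary: t i)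
  case (Suc n)
  then have "t < k * k ^ n" "i < a * a ^ n" by auto
  from this[THEN div_mod_less(1)] this[THEN div_mod_less(2)] show ?case
    using Suc.IH assms(1) by (simp add: tensor2_def)
qed simp

lemma tensor_pow_sum_le_one:
  fixes W :: "nat \<Rightarrow> nat \<Rightarrow> real"
  assumes "\<And>t i. t < k \<Longrightarrow> i < a \<Longrightarrow> 0 < W t i" "\<And>t. t < k \<Longrightarrow> (\<Sum>i<a. W t i) \<le> 1" "t < k ^ n"
  shows "(\<Sum>i<a ^ n. tensor_pow k a W n t i) \<le> 1"
  using assms(3)
proof (induction n arbitrary: t)
  case (Suc n)
  then have "t < k * k ^ n" by simp
  note dm = div_mod_less[OF this]
  have "(\<Sum>i<a ^ n. tensor_pow k a W n (t mod k ^ n) i) \<le> 1" "(\<Sum>i<a. W (t div k ^ n) i) \<le> 1"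
    using Suc.IH assms(2) dm by auto
  moreover have "0 \<le> (\<Sum>i<a ^ n. tensor_pow k a W n (t mod k ^ n) i)"
    using dm by (intro sum_nonneg less_imp_le tensor_pow_pos assms(1)) auto
  moreover have "0 \<le> (\<Sum>i<a. W (t div k ^ n) i)"
    using dm by (intro sum_nonneg less_imp_le assms(1)) auto
  ultimately have "(\<Sum>i<a. W (t div k ^ n) i) * (\<Sum>i<a ^ n. tensor_pow k a W n (t mod k ^ n) i) \<le> 1"
    by (intro mult_le_one)
  then show ?case by (simp add: tensor2_def sum_div_mod)
qed simp

lemma tensor_pow_sum_outcomes:
  fixes w :: "nat \<Rightarrow> nat \<Rightarrow> real"
  assumes "\<And>i. i < a \<Longrightarrow> (\<Sum>t<k. w t i) = 1" "i < a ^ n"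
  shows "(\<Sum>t<k ^ n. tensor_pow k a w n t i) = 1"
  using assms(2)
proof (induction n arbitrary: i)
  case (Suc n)
  then have "i < a * a ^ n" by simp
  note dm = div_mod_less[OF this]
  have "(\<Sum>t<k ^ Suc n. tensor_pow k a w (Suc n) t i) =
      (\<Sum>t<k. w t (i div a ^ n)) * (\<Sum>t<k ^ n. tensor_pow k a w n t (i mod a ^ n))"
    by (simp add: tensor2_def sum_div_mod[where f = "\<lambda>t. w t (i div a ^ n)" and g = "\<lambda>t. tensor_pow k a w n t (i mod a ^ n)"])
  also have "\<dots> = 1" using Suc.IH assms(1) dm by simp
  finally show ?case .
qed simp

text \<open>The logarithm turns the product \<open>W\<close> into a sum, and the weights of the
  remaining positions sum to 1, so the expected loss adds up letter by letter.\<close>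

lemma tensor_pow_expected_log:
  fixes w W :: "nat \<Rightarrow> nat \<Rightarrow> real"
  assumes w: "\<And>i. i < a \<Longrightarrow> (\<Sum>t<k. w t i) = 1"
    and W: "\<And>t i. t < k \<Longrightarrow> i < a \<Longrightarrow> 0 < W t i" and "i < a ^ n"
  shows "(\<Sum>t<k ^ n. tensor_pow k a w n t i * - log 2 (tensor_pow k a W n t i)) =
    letter_sum a (\<lambda>i. \<Sum>t<k. w t i * - log 2 (W t i)) n i"
  using assms(3)
proof (induction n arbitrary: i)
  case (Suc n)
  then have "i < a * a ^ n" by simp
  note i = div_mod_less[OF this]
  let ?i = "i div a ^ n" and ?i' = "i mod a ^ n"
  let ?w = "tensor_pow k a w n" and ?W = "tensor_pow k a W n"
  have "(\<Sum>t<k ^ Suc n. tensor_pow k a w (Suc n) t i * - log 2 (tensor_pow k a W (Suc n) t i)) =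
    (\<Sum>t<k * k ^ n. (w (t div k ^ n) ?i * - log 2 (W (t div k ^ n) ?i)) * ?w (t mod k ^ n) ?i'
        + w (t div k ^ n) ?i * (?w (t mod k ^ n) ?i' * - log 2 (?W (t mod k ^ n) ?i')))"
  proof (simp only: power_Suc, rule sum.cong[OF refl])
    fix t assume "t \<in> {..<k * k ^ n}"
    then have "t < k * k ^ n" by simp
    note t = div_mod_less[OF this]
    have "0 < W (t div k ^ n) ?i" "0 < ?W (t mod k ^ n) ?i'"
      using W tensor_pow_pos[OF W] t i by auto
    then have "log 2 (tensor_pow k a W (Suc n) t i) = log 2 (W (t div k ^ n) ?i) + log 2 (?W (t mod k ^ n) ?i')"
      by (simp add: tensor2_def log_mult)
    then show "tensor_pow k a w (Suc n) t i * - log 2 (tensor_pow k a W (Suc n) t i) =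
        (w (t div k ^ n) ?i * - log 2 (W (t div k ^ n) ?i)) * ?w (t mod k ^ n) ?i'
        + w (t div k ^ n) ?i * (?w (t mod k ^ n) ?i' * - log 2 (?W (t mod k ^ n) ?i'))"
      by (simp only: tensor_pow.simps tensor2_def) (simp add: algebra_simps)
  qed
  also have "\<dots> = (\<Sum>t<k. w t ?i * - log 2 (W t ?i)) * (\<Sum>t<k ^ n. ?w t ?i')
      + (\<Sum>t<k. w t ?i) * (\<Sum>t<k ^ n. ?w t ?i' * - log 2 (?W t ?i'))"
    unfolding sum.distrib
    by (intro arg_cong2[where f = "(+)"] sum_div_mod[where f = "\<lambda>t. w t ?i * - log 2 (W t ?i)" and g = "\<lambda>t. ?w t ?i'"]
      sum_div_mod[where f = "\<lambda>t. w t ?i" and g = "\<lambda>t. ?w t ?i' * - log 2 (?W t ?i')"])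
  also have "\<dots> = letter_sum a (\<lambda>i. \<Sum>t<k. w t i * - log 2 (W t i)) (Suc n) i"
    using Suc.IH[OF i(2)] i w tensor_pow_sum_outcomes[OF w] by simp
  finally show ?case .
qed simp

subsection \<open>The converse for codes\<close>

lemma sum_swap3:
  "(\<Sum>t\<in>A. \<Sum>s\<in>B. \<Sum>p\<in>C. f t s p) = (\<Sum>p\<in>C. \<Sum>t\<in>A. \<Sum>s\<in>B. f t s p)"
proof -
  have "(\<Sum>t\<in>A. \<Sum>s\<in>B. \<Sum>p\<in>C. f t s p) = (\<Sum>t\<in>A. \<Sum>p\<in>C. \<Sum>s\<in>B. f t s p)"
    by (intro sum.cong refl sum.swap)
  also have "\<dots> = (\<Sum>p\<in>C. \<Sum>t\<in>A. \<Sum>s\<in>B. f t s p)" by (rule sum.swap)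
  finally show ?thesis .
qed

lemma sum_swap4:
  "(\<Sum>t\<in>A. \<Sum>s\<in>B. \<Sum>p\<in>C. \<Sum>q\<in>D. f t s p q) = (\<Sum>p\<in>C. \<Sum>q\<in>D. \<Sum>t\<in>A. \<Sum>s\<in>B. f t s p q)"
  unfolding sum_swap3[of _ C B A] by (intro sum.cong refl sum_swap3)

text \<open>The vectors \<open>R s\<close> decompose the state \<open>X\<close>, and
  \<open>c s\<close> lists the coordinates of \<open>R s\<close> in the basis \<open>U\<close>, on
  which the Kraus operator \<open>t\<close> acts through the columns of \<open>C t\<close>.\<close>

lemma kraus_system_output:
  fixes R :: "nat \<Rightarrow> nat \<Rightarrow> complex"
  assumes K: "kraus_system a b e k F G \<phi> C U w"
    and lin: "F X $$ (r, r') = (\<Sum>p<a. \<Sum>q<a. X $$ (p, q) * F (matrix_unit a p q) $$ (r, r'))"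
    and X: "\<And>p q. p < a \<Longrightarrow> q < a \<Longrightarrow> X $$ (p, q) = (\<Sum>s<n. R s p * cnj (R s q))"
    and r: "r < b" "r' < b"
  defines "c \<equiv> \<lambda>s x. \<Sum>p<a. R s p * cnj (U x p)"
  shows "F X $$ (r, r') = (\<Sum>t<k. \<Sum>s<n. (\<Sum>x<a. c s x * C t r x) * cnj (\<Sum>x<a. c s x * C t r' x))"
proof -
  define B where "B t r p = (\<Sum>i<a. C t r i * cnj (U i p))" for t r p
  have A: "(\<Sum>x<a. c s x * C t r x) = (\<Sum>p<a. R s p * B t r p)" for s t r
  proof -
    have "(\<Sum>x<a. c s x * C t r x) = (\<Sum>x<a. \<Sum>p<a. R s p * (C t r x * cnj (U x p)))"
      unfolding c_def sum_distrib_right by (simp add: mult_ac)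
    also have "\<dots> = (\<Sum>p<a. \<Sum>x<a. R s p * (C t r x * cnj (U x p)))" by (rule sum.swap)
    finally show ?thesis by (simp add: B_def sum_distrib_left)
  qed
  have "(\<Sum>t<k. \<Sum>s<n. (\<Sum>x<a. c s x * C t r x) * cnj (\<Sum>x<a. c s x * C t r' x)) =
     (\<Sum>t<k. \<Sum>s<n. \<Sum>p<a. \<Sum>q<a. R s p * B t r p * cnj (R s q * B t r' q))"
    unfolding A cnj_sum sum_product ..
  also have "\<dots> = (\<Sum>p<a. \<Sum>q<a. \<Sum>t<k. \<Sum>s<n. R s p * B t r p * cnj (R s q * B t r' q))"
    by (rule sum_swap4)
  also have "\<dots> = (\<Sum>p<a. \<Sum>q<a. X $$ (p, q) * F (matrix_unit a p q) $$ (r, r'))"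
  proof (intro sum.cong refl)
    fix p q assume "p \<in> {..<a}" "q \<in> {..<a}"
    then have pq: "p < a" "q < a" by auto
    have "F (matrix_unit a p q) $$ (r, r') = (\<Sum>t<k. B t r p * cnj (B t r' q))"
      using K pq r unfolding kraus_system_def B_def by simp
    then have "X $$ (p, q) * F (matrix_unit a p q) $$ (r, r') =
        (\<Sum>s<n. \<Sum>t<k. R s p * cnj (R s q) * (B t r p * cnj (B t r' q)))"
      using pq by (simp only: X sum_product)
    also have "\<dots> = (\<Sum>t<k. \<Sum>s<n. R s p * cnj (R s q) * (B t r p * cnj (B t r' q)))"
      by (rule sum.swap)
    finally show "(\<Sum>t<k. \<Sum>s<n. R s p * B t r p * cnj (R s q * B t r' q)) =
        X $$ (p, q) * F (matrix_unit a p q) $$ (r, r')" by (simp add: mult_ac)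
  qed
  finally show ?thesis using lin by simp
qed

text \<open>Splitting the state and Bob's effect into rank-one terms makes the probability a sum of
  squared amplitudes, in the form that \<open>one_shot_converse\<close> bounds.\<close>

lemma kraus_system_measured_output:
  fixes R d :: "nat \<Rightarrow> nat \<Rightarrow> complex"
  assumes K: "kraus_system a b e k F G \<phi> C U w"
    and lin: "\<And>r r'. r < b \<Longrightarrow> r' < b \<Longrightarrow>
      F X $$ (r, r') = (\<Sum>p<a. \<Sum>q<a. X $$ (p, q) * F (matrix_unit a p q) $$ (r, r'))"
    and X: "\<And>p q. p < a \<Longrightarrow> q < a \<Longrightarrow> X $$ (p, q) = (\<Sum>s<n. R s p * cnj (R s q))"
    and D: "\<And>r r'. r < b \<Longrightarrow> r' < b \<Longrightarrow> D $$ (r, r') = (\<Sum>l<m. d l r * cnj (d l r'))"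
  defines "c \<equiv> \<lambda>s x. \<Sum>p<a. R s p * cnj (U x p)"
  shows "(\<Sum>r<b. \<Sum>r'<b. F X $$ (r, r') * D $$ (r', r)) = complex_of_real
    (\<Sum>t<k. \<Sum>s<n. \<Sum>l<m. (cmod (\<Sum>x<a. c s x * (\<Sum>r<b. C t r x * cnj (d l r))))\<^sup>2)"
proof -
  let ?g = "\<lambda>t s r. \<Sum>x<a. c s x * C t r x"
  have z: "(\<Sum>r<b. ?g t s r * cnj (d l r)) = (\<Sum>x<a. c s x * (\<Sum>r<b. C t r x * cnj (d l r)))" for t s l
  proof -
    have "(\<Sum>r<b. ?g t s r * cnj (d l r)) = (\<Sum>r<b. \<Sum>x<a. c s x * (C t r x * cnj (d l r)))"
      by (simp add: sum_distrib_right mult.assoc)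
    also have "\<dots> = (\<Sum>x<a. \<Sum>r<b. c s x * (C t r x * cnj (d l r)))" by (rule sum.swap)
    finally show ?thesis by (simp add: sum_distrib_left)
  qed
  have "(\<Sum>r<b. \<Sum>r'<b. F X $$ (r, r') * D $$ (r', r)) =
      (\<Sum>r<b. \<Sum>r'<b. \<Sum>t<k. \<Sum>s<n. ?g t s r * cnj (?g t s r') * D $$ (r', r))"
    using kraus_system_output[OF K lin X] unfolding c_def
    by (intro sum.cong refl) (simp add: sum_distrib_right)
  also have "\<dots> = (\<Sum>t<k. \<Sum>s<n. \<Sum>r<b. \<Sum>r'<b. ?g t s r * cnj (?g t s r') * D $$ (r', r))"
    by (rule sum_swap4)
  also have "\<dots> = (\<Sum>t<k. \<Sum>s<n. \<Sum>r<b. \<Sum>r'<b. \<Sum>l<m. (?g t s r * cnj (d l r)) * cnj (?g t s r' * cnj (d l r')))"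
  proof (intro sum.cong refl)
    fix t s r r' assume "r \<in> {..<b}" "r' \<in> {..<b}"
    then have D': "D $$ (r', r) = (\<Sum>l<m. d l r' * cnj (d l r))" by (simp add: D)
    have "\<alpha> * cnj \<beta> * (\<Sum>l<m. d l r' * cnj (d l r)) =
        (\<Sum>l<m. (\<alpha> * cnj (d l r)) * cnj (\<beta> * cnj (d l r')))" for \<alpha> \<beta>
      by (simp add: sum_distrib_left mult_ac)
    then show "?g t s r * cnj (?g t s r') * D $$ (r', r) =
        (\<Sum>l<m. (?g t s r * cnj (d l r)) * cnj (?g t s r' * cnj (d l r')))"
      unfolding D' .
  qed
  also have "\<dots> = (\<Sum>t<k. \<Sum>s<n. \<Sum>l<m. \<Sum>r<b. \<Sum>r'<b. (?g t s r * cnj (d l r)) * cnj (?g t s r' * cnj (d l r')))"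
    by (intro sum.cong refl sum_swap3)
  also have "\<dots> = (\<Sum>t<k. \<Sum>s<n. \<Sum>l<m. (\<Sum>r<b. ?g t s r * cnj (d l r)) * cnj (\<Sum>r<b. ?g t s r * cnj (d l r)))"
    unfolding cnj_sum sum_product ..
  finally show ?thesis
    by (simp only: z of_real_sum complex_norm_square)
qed

text \<open>Parseval for the basis \<open>U\<close>: the weights of a density operator in this basis
  form a probability distribution.\<close>

lemma kraus_system_input_total:
  fixes R :: "nat \<Rightarrow> nat \<Rightarrow> complex"
  assumes U: "\<And>p q. p < a \<Longrightarrow> q < a \<Longrightarrow> (\<Sum>i<a. U i p * cnj (U i q)) = (if p = q then 1 else 0)"
    and X: "\<And>p. p < a \<Longrightarrow> X $$ (p, p) = (\<Sum>s<n. R s p * cnj (R s p))"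
  shows "complex_of_real (\<Sum>x<a. \<Sum>s<n. (cmod (\<Sum>p<a. R s p * cnj (U x p)))\<^sup>2) = (\<Sum>p<a. X $$ (p, p))"
proof -
  have "(\<Sum>x<a. \<Sum>s<n. (cmod (\<Sum>p<a. R s p * cnj (U x p)))\<^sup>2)
      = (\<Sum>s<n. \<Sum>x<a. (cmod (\<Sum>p<a. R s p * cnj (U x p)))\<^sup>2)" by (rule sum.swap)
  also have "\<dots> = (\<Sum>s<n. \<Sum>p<a. (cmod (R s p))\<^sup>2 * 1)"
  proof (rule sum.cong[OF refl], rule norm_sum_orthogonal)
    fix p q assume "p \<in> {..<a}" "q \<in> {..<a}"
    then show "(\<Sum>x<a. cnj (U x p) * cnj (cnj (U x q))) = (if p = q then complex_of_real 1 else 0)"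
      using U[of q p] by (auto simp: mult.commute)
  qed simp
  finally have eq: "(\<Sum>x<a. \<Sum>s<n. (cmod (\<Sum>p<a. R s p * cnj (U x p)))\<^sup>2) = (\<Sum>s<n. \<Sum>p<a. (cmod (R s p))\<^sup>2 * 1)" .
  have "complex_of_real (\<Sum>s<n. \<Sum>p<a. (cmod (R s p))\<^sup>2 * 1) = (\<Sum>s<n. \<Sum>p<a. R s p * cnj (R s p))"
    by (simp only: of_real_sum complex_norm_square mult_1_right)
  also have "\<dots> = (\<Sum>p<a. \<Sum>s<n. R s p * cnj (R s p))" by (rule sum.swap)
  finally show ?thesis unfolding eq using X by simp
qed

text \<open>Only the diagonal of \<open>X\<close> in the basis \<open>U\<close> enters: Eve's
  measurement sees the input through the classical channel \<open>w\<close>.\<close>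

lemma kraus_system_eve:
  fixes R :: "nat \<Rightarrow> nat \<Rightarrow> complex"
  assumes K: "kraus_system a b e k F G \<phi> C U w"
    and lin: "\<And>x y. x < e \<Longrightarrow> y < e \<Longrightarrow>
      G X $$ (x, y) = (\<Sum>p<a. \<Sum>q<a. X $$ (p, q) * G (matrix_unit a p q) $$ (x, y))"
    and X: "\<And>p q. p < a \<Longrightarrow> q < a \<Longrightarrow> X $$ (p, q) = (\<Sum>s<n. R s p * cnj (R s q))"
    and t: "t < k"
  shows "(\<Sum>x<e. \<Sum>y<e. G X $$ (x, y) * (\<phi> t y * cnj (\<phi> t x))) = complex_of_real
    (\<Sum>i<a. (\<Sum>s<n. (cmod (\<Sum>p<a. R s p * cnj (U i p)))\<^sup>2) * w t i)"
proof -
  let ?v = "\<lambda>x y. \<phi> t y * cnj (\<phi> t x)"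
  have "(\<Sum>x<e. \<Sum>y<e. G X $$ (x, y) * ?v x y)
    = (\<Sum>x<e. \<Sum>y<e. \<Sum>p<a. \<Sum>q<a. X $$ (p, q) * (G (matrix_unit a p q) $$ (x, y) * ?v x y))"
    by (intro sum.cong refl) (simp add: lin sum_distrib_right mult.assoc)
  also have "\<dots> = (\<Sum>p<a. \<Sum>q<a. \<Sum>x<e. \<Sum>y<e. X $$ (p, q) * (G (matrix_unit a p q) $$ (x, y) * ?v x y))"
    by (rule sum_swap4)
  also have "\<dots> = (\<Sum>p<a. \<Sum>q<a. X $$ (p, q) * (\<Sum>i<a. complex_of_real (w t i) * (cnj (U i p) * U i q)))"
    unfolding sum_distrib_left[symmetric] using K t
    by (intro sum.cong refl) (simp add: kraus_system_def)
  also have "\<dots> = (\<Sum>p<a. \<Sum>q<a. \<Sum>s<n. \<Sum>i<a. of_real (w t i) * ((R s p * cnj (U i p)) * cnj (R s q * cnj (U i q))))"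
    by (intro sum.cong refl) (simp add: X sum_product mult_ac)
  also have "\<dots> = (\<Sum>s<n. \<Sum>i<a. \<Sum>p<a. \<Sum>q<a. of_real (w t i) * ((R s p * cnj (U i p)) * cnj (R s q * cnj (U i q))))"
    by (rule sum_swap4)
  also have "\<dots> = (\<Sum>s<n. \<Sum>i<a. of_real (w t i) *
      ((\<Sum>p<a. R s p * cnj (U i p)) * cnj (\<Sum>p<a. R s p * cnj (U i p))))"
    unfolding cnj_sum sum_product unfolding sum_distrib_left ..
  also have "\<dots> = (\<Sum>i<a. \<Sum>s<n. of_real (w t i) *
      ((\<Sum>p<a. R s p * cnj (U i p)) * cnj (\<Sum>p<a. R s p * cnj (U i p))))"
    by (rule sum.swap)
  also have "\<dots> = complex_of_real (\<Sum>i<a. w t i * (\<Sum>s<n. (cmod (\<Sum>p<a. R s p * cnj (U i p)))\<^sup>2))"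
    by (simp only: of_real_sum of_real_mult complex_norm_square sum_distrib_left)
  finally show ?thesis by (simp only: mult.commute)
qed

text \<open>Orthogonal columns turn the output trace into the weights \<open>w t x\<close>, whose
  sum over \<open>t\<close> is 1; what remains is the trace of the input by Parseval.\<close>

lemma kraus_system_output_trace:
  fixes R :: "nat \<Rightarrow> nat \<Rightarrow> complex"
  assumes K: "kraus_system a b e k F G \<phi> C U w"
    and lin: "\<And>r r'. r < b \<Longrightarrow> r' < b \<Longrightarrow>
      F X $$ (r, r') = (\<Sum>p<a. \<Sum>q<a. X $$ (p, q) * F (matrix_unit a p q) $$ (r, r'))"
    and X: "\<And>p q. p < a \<Longrightarrow> q < a \<Longrightarrow> X $$ (p, q) = (\<Sum>s<n. R s p * cnj (R s q))"
  shows "(\<Sum>r<b. F X $$ (r, r)) = (\<Sum>p<a. X $$ (p, p))"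
proof -
  define c where "c s x = (\<Sum>p<a. R s p * cnj (U x p))" for s x
  let ?g = "\<lambda>t s r. \<Sum>x<a. c s x * C t r x"
  have w: "(\<Sum>t<k. w t x) = 1" if "x < a" for x using K that by (simp add: kraus_system_def)
  have "(\<Sum>r<b. F X $$ (r, r)) = (\<Sum>r<b. \<Sum>t<k. \<Sum>s<n. ?g t s r * cnj (?g t s r))"
    unfolding c_def using kraus_system_output[OF K lin X] by (intro sum.cong refl) simp
  also have "\<dots> = (\<Sum>t<k. \<Sum>s<n. \<Sum>r<b. ?g t s r * cnj (?g t s r))" by (rule sum_swap3[symmetric])
  also have "\<dots> = complex_of_real (\<Sum>t<k. \<Sum>s<n. \<Sum>r<b. (cmod (?g t s r))\<^sup>2)"
    by (simp only: of_real_sum complex_norm_square)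
  also have "(\<Sum>t<k. \<Sum>s<n. \<Sum>r<b. (cmod (?g t s r))\<^sup>2) = (\<Sum>t<k. \<Sum>s<n. \<Sum>x<a. (cmod (c s x))\<^sup>2 * w t x)"
    using K by (intro sum.cong refl norm_sum_orthogonal) (auto simp: kraus_system_def)
  also have "\<dots> = (\<Sum>x<a. \<Sum>t<k. \<Sum>s<n. (cmod (c s x))\<^sup>2 * w t x)" by (rule sum_swap3)
  also have "\<dots> = (\<Sum>x<a. (\<Sum>t<k. w t x) * (\<Sum>s<n. (cmod (c s x))\<^sup>2))"
    by (simp add: sum_product mult.commute)
  also have "\<dots> = (\<Sum>x<a. \<Sum>s<n. (cmod (c s x))\<^sup>2)" using w by simp
  also have "complex_of_real \<dots> = (\<Sum>p<a. X $$ (p, p))"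
    unfolding c_def using K X by (intro kraus_system_input_total) (auto simp: kraus_system_def)
  finally show ?thesis .
qed

text \<open>The auxiliary qubits are the leading part of \<open>x\<close> and invisible to Eve, so
  \<open>w\<close> depends only on \<open>x mod dA ^ n\<close>. The basis is explicit and built from
  \<open>U\<close> alone, which lets Eve's measurement vary while the basis stays fixed.\<close>

lemma kraus_system_code:
  assumes "kraus_system dA dB dE k N Nc \<phi> C U w"
  shows "\<exists>\<phi>' C'. kraus_system (2 ^ \<kappa> * dA ^ n) (2 ^ \<kappa> * dB ^ n) (dE ^ n) (k ^ n)
    (bob_output dA dB N n \<kappa>) (eve_output dA dE Nc n \<kappa>) \<phi>' C'
    (tensor2 (dA ^ n) (dA ^ n) (tensor_pow 2 2 (\<lambda>i p. if i = p then 1 else 0) \<kappa>) (tensor_pow dA dA U n))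
    (\<lambda>t x. tensor_pow k dA w n (t mod k ^ n) (x mod dA ^ n))"
proof -
  obtain C1 where 1: "kraus_system (dA ^ n) (dB ^ n) (dE ^ n) (k ^ n)
    (map_tensor_pow dA dB N n) (map_tensor_pow dA dE Nc n)
    (tensor_pow k dE \<phi> n) C1 (tensor_pow dA dA U n) (tensor_pow k dA w n)"
    using kraus_system_pow[OF assms] by blast
  obtain C2 where 2: "kraus_system (2 ^ \<kappa>) (2 ^ \<kappa>) (1 ^ \<kappa>) (1 ^ \<kappa>)
    (map_tensor_pow 2 2 (\<lambda>X. X) \<kappa>) (map_tensor_pow 2 1 (\<lambda>X. mat 1 1 (\<lambda>_. mtrace X)) \<kappa>)
    (tensor_pow 1 1 (\<lambda>_ _. 1) \<kappa>) C2 (tensor_pow 2 2 (\<lambda>i p. if i = p then 1 else 0) \<kappa>)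
    (tensor_pow 1 2 (\<lambda>_ _. 1) \<kappa>)"
    using kraus_system_pow[OF kraus_system_qubit] by blast
  have w: "tensor2 (k ^ n) (dA ^ n) (tensor_pow 1 2 (\<lambda>_ _. 1) \<kappa>) (tensor_pow k dA w n) =
      (\<lambda>t x. tensor_pow k dA w n (t mod k ^ n) (x mod dA ^ n))"
    by (simp add: fun_eq_iff tensor2_def tensor_pow_one)
  show ?thesis
    using kraus_system_tensor[OF 2 1] unfolding w bob_output_def[symmetric] eve_output_def[symmetric]
    by (simp only: power_one mult_1) blast
qed

section \<open>Rank-one measurements and trace formulas\<close>

lemma rank_one_povm:
  fixes \<phi> :: "nat \<Rightarrow> nat \<Rightarrow> complex"
  assumes "\<And>x y. x < d \<Longrightarrow> y < d \<Longrightarrow> (\<Sum>t<k. \<phi> t x * cnj (\<phi> t y)) = (if x = y then 1 else 0)"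
  shows "povm d k (\<lambda>t. outer (vec d (\<phi> t)) (vec d (\<phi> t)))"
  unfolding povm_def psd_def
proof (intro conjI allI impI ballI)
  fix t :: nat and v :: "complex vec" assume v: "v \<in> carrier_vec d"
  let ?z = "\<Sum>p<d. \<phi> t p * cnj (v $ p)"
  have "(outer (vec d (\<phi> t)) (vec d (\<phi> t)) *\<^sub>v v) \<bullet>c v = ?z * cnj ?z"
    unfolding cnj_sum sum_product using v
    by (auto simp: outer_def scalar_prod_def lessThan_atLeast0 sum_distrib_left sum_distrib_right mult_ac intro!: sum.cong)
  also have "\<dots> = of_real ((cmod ?z)\<^sup>2)" by (simp only: complex_norm_square)
  finally show "0 \<le> (outer (vec d (\<phi> t)) (vec d (\<phi> t)) *\<^sub>v v) \<bullet>c v" by (simp add: less_eq_complex_def)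
next
  show "mat d d (\<lambda>rc. \<Sum>t<k. outer (vec d (\<phi> t)) (vec d (\<phi> t)) $$ rc) = 1\<^sub>m d"
    using assms by (intro eq_matI) (simp_all add: outer_def)
qed (simp add: outer_def)

lemma mtrace_mult_outer:
  assumes "Y \<in> carrier_mat d d"
  shows "mtrace (Y * outer (vec d f) (vec d f)) = (\<Sum>x<d. \<Sum>y<d. Y $$ (x, y) * (f y * cnj (f x)))"
  using assms by (simp add: mtrace_def outer_def scalar_prod_def lessThan_atLeast0)

lemma mtrace_mult_one_minus:
  assumes "Y \<in> carrier_mat d d" "D \<in> carrier_mat d d"
  shows "mtrace (Y * (1\<^sub>m d - D)) = (\<Sum>r<d. Y $$ (r, r)) - (\<Sum>r<d. \<Sum>r'<d. Y $$ (r, r') * D $$ (r', r))"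
proof -
  have "(Y * (1\<^sub>m d - D)) $$ (r, r) = Y $$ (r, r) - (\<Sum>r'<d. Y $$ (r, r') * D $$ (r', r))"
    if r: "r < d" for r
  proof -
    have "(Y * (1\<^sub>m d - D)) $$ (r, r) = (\<Sum>r'<d. Y $$ (r, r') * ((if r' = r then 1 else 0) - D $$ (r', r)))"
      using assms r by (simp add: scalar_prod_def lessThan_atLeast0)
    also have "\<dots> = (\<Sum>r'<d. (if r' = r then Y $$ (r, r') else 0) - Y $$ (r, r') * D $$ (r', r))"
      by (intro sum.cong refl) (simp add: algebra_simps)
    finally show ?thesis using r by (simp add: sum_subtractf)
  qed
  then show ?thesis using assms by (simp add: mtrace_def sum_subtractf)
qed

text \<open>One distribution suffices, here a point mass: \<open>0 < W t i \<le> 1\<close> makes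
  every term of the loss nonnegative. The sign of \<open>h\<close> makes the rate \<open>r\<close>
  of the final limit positive.\<close>

lemma entropy_bound_nonneg:
  assumes dA: "0 < dA" and compl: "complementary_channel dA dB dE N Nc" and cq: "cq_channel dA dE Nc e \<rho>"
    and h: "\<And>p. prob_vector dA p \<Longrightarrow> acc_cond_entropy dA dE p \<rho> < ereal h"
  shows "0 \<le> h"
proof -
  let ?p = "\<lambda>i. if i = 0 then 1 else 0 :: real"
  have p: "prob_vector dA ?p" using dA by (simp add: prob_vector_def)
  obtain k \<phi> C w W where K: "kraus_system dA dB dE k N Nc \<phi> C (\<lambda>i p. e i $ p) w"
    and W: "\<forall>t<k. \<forall>i<dA. 0 < W t i" "\<forall>t<k. (\<Sum>i<dA. W t i) \<le> 1"
    and le: "(\<Sum>i<dA. ?p i * (\<Sum>t<k. w t i * - log 2 (W t i))) \<le> h"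
    using good_measurement[OF dA compl cq p h[OF p]] by blast
  have "W t i \<le> 1" if ti: "t < k" "i < dA" for t i
  proof -
    have "W t i \<le> (\<Sum>i<dA. W t i)"
      using ti W by (intro member_le_sum) (auto intro: less_imp_le)
    also have "\<dots> \<le> 1" using W ti by simp
    finally show ?thesis .
  qed
  then have "0 \<le> (\<Sum>i<dA. ?p i * (\<Sum>t<k. w t i * - log 2 (W t i)))"
    using W kraus_system_nonneg[OF K] by (intro sum_nonneg mult_nonneg_nonneg) auto
  then show ?thesis using le by linarith
qed

text \<open>\<open>A\<close> is a threshold in bits: \<open>one_shot_converse\<close> is applied
  with at most \<open>2 powr A\<close> likely inputs per outcome of Eve, and Markov's inequality
  bounds the probability of an unlikely input by the expected loss divided by
  \<open>A\<close>.\<close>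

lemma code_bound:
  assumes dA: "0 < dA" and compl: "complementary_channel dA dB dE N Nc" and cq: "cq_channel dA dE Nc e \<rho>"
    and code: "is_code dA dB N n \<kappa> \<epsilon> M \<sigma> D" and locked: "weakly_locked dA dE Nc n \<kappa> \<delta> M \<sigma>"
    and h: "\<And>p. prob_vector dA p \<Longrightarrow> acc_cond_entropy dA dE p \<rho> < ereal h" and A: "0 < A"
  shows "sqrt (1 - \<epsilon>) \<le> sqrt (2 powr A / real M + \<delta>) + sqrt ((real \<kappa> + real n * h) / A)"
proof -
  define a where "a = 2 ^ \<kappa> * dA ^ n"
  define b where "b = 2 ^ \<kappa> * dB ^ n"
  define U where "U = tensor2 (dA ^ n) (dA ^ n)
    (tensor_pow 2 2 (\<lambda>i p. if i = p then 1 else (0::complex)) \<kappa>) (tensor_pow dA dA (\<lambda>i p. e i $ p) n)"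
  have n: "1 \<le> n" and M: "1 \<le> M" and dens: "\<And>m. m < M \<Longrightarrow> density_operator a (\<sigma> m)"
    and povm: "povm b M D"
    and err: "1 / real M * (\<Sum>m<M. Re (mtrace (bob_output dA dB N n \<kappa> (\<sigma> m) * (1\<^sub>m b - D m)))) \<le> \<epsilon>"
    using code unfolding is_code_def a_def b_def by auto
  obtain R where R: "\<And>m p q. m < M \<Longrightarrow> p < a \<Longrightarrow> q < a \<Longrightarrow> \<sigma> m $$ (p, q) = (\<Sum>s<a. R m s p * cnj (R m s q))"
  proof -
    have "\<forall>m\<in>{..<M}. \<exists>L. \<forall>p<a. \<forall>q<a. \<sigma> m $$ (p, q) = (\<Sum>s<a. L s p * cnj (L s q))"
      using dens by (auto simp: density_operator_def intro!: psd_decomposition)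
    from bchoice[OF this] show ?thesis using that by blast
  qed
  obtain d where d: "\<And>m p q. m < M \<Longrightarrow> p < b \<Longrightarrow> q < b \<Longrightarrow> D m $$ (p, q) = (\<Sum>l<b. d m l p * cnj (d m l q))"
  proof -
    have "\<forall>m\<in>{..<M}. \<exists>L. \<forall>p<b. \<forall>q<b. D m $$ (p, q) = (\<Sum>l<b. L l p * cnj (L l q))"
      using povm by (auto simp: povm_def intro!: psd_decomposition)
    from bchoice[OF this] show ?thesis using that by blast
  qed
  define c where "c m s x = (\<Sum>p<a. R m s p * cnj (U x p))" for m s x
  define P where "P m x = (\<Sum>s<a. (cmod (c m s x))\<^sup>2)" for m x
  have P0: "0 \<le> P m x" for m x unfolding P_def by (rule sum_nonneg) simp
  have P1: "(\<Sum>x<a. P m x) = 1" if m: "m < M" for m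
  proof -
    \<comment> \<open>The standard basis of \<open>E\<close> is one admissible measurement; its
      Kraus system supplies the completeness of \<open>U\<close>.\<close>
    let ?id = "\<lambda>t x. if t = x then 1 else (0::complex)"
    have "(\<Sum>t<dE. ?id t x * cnj (?id t y)) = (if x = y then 1 else 0)" if "x < dE" "y < dE" for x y
    proof -
      have "(\<Sum>t<dE. ?id t x * cnj (?id t y)) = (\<Sum>t<dE. if t = x then ?id x y else 0)"
        by (intro sum.cong refl) auto
      then show ?thesis using that by simp
    qed
    from kraus_system_cq[OF compl cq this] obtain C w where
      K: "kraus_system dA dB dE dE N Nc ?id C (\<lambda>i p. e i $ p) w" by blast
    have "complex_of_real (\<Sum>x<a. P m x) = (\<Sum>p<a. \<sigma> m $$ (p, p))"
      unfolding P_def c_def using kraus_system_code[OF K, of \<kappa> n] R[OF m]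
      by (intro kraus_system_input_total) (auto simp: kraus_system_def U_def[symmetric] a_def[symmetric])
    also have "\<dots> = mtrace (\<sigma> m)"
      using dens[OF m] by (auto simp: mtrace_def density_operator_def psd_def)
    also have "\<dots> = 1" using dens[OF m] by (simp add: density_operator_def)
    finally show ?thesis by (metis of_real_eq_1_iff)
  qed
  \<comment> \<open>the basis \<open>U\<close> does not depend on Eve's measurement, so that measurement may be adapted to \<open>P\<close>\<close>
  define freq where "freq j x = letter_sum dA (\<lambda>i. of_bool (i = j)) n (x mod dA ^ n)" for j x
  have mod: "x mod dA ^ n < dA ^ n" for x using dA by simp
  \<comment> \<open>The input letter distribution averaged over messages and over the
    \<open>n\<close> positions.\<close>
  define pbar where "pbar j = (\<Sum>m<M. \<Sum>x<a. P m x * freq j x) / (real M * real n)" for j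
  have pbar: "prob_vector dA pbar"
    unfolding prob_vector_def
  proof (intro conjI allI impI)
    show "0 \<le> pbar j" for j
      unfolding pbar_def freq_def using P0
      by (intro divide_nonneg_nonneg sum_nonneg mult_nonneg_nonneg letter_sum_nonneg[OF _ mod]) auto
    have fr: "(\<Sum>j<dA. freq j x) = real n" for x
      using letter_sum_indicator[OF mod, of "\<lambda>_. 1" x] by (simp add: freq_def letter_sum_one)
    have "(\<Sum>j<dA. \<Sum>m<M. \<Sum>x<a. P m x * freq j x) = (\<Sum>m<M. \<Sum>x<a. P m x * (\<Sum>j<dA. freq j x))"
      unfolding sum_distrib_left by (rule sum_swap3[symmetric])
    also have "\<dots> = (\<Sum>m<M. (\<Sum>x<a. P m x) * real n)"
      by (simp add: fr sum_distrib_right)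
    also have "\<dots> = real M * real n" by (simp add: P1)
    finally show "(\<Sum>j<dA. pbar j) = 1"
      using n M by (simp add: pbar_def sum_divide_distrib[symmetric])
  qed
  obtain k \<phi>1 C1 w1 W1 where K1: "kraus_system dA dB dE k N Nc \<phi>1 C1 (\<lambda>i p. e i $ p) w1"
    and W1: "\<And>t i. t < k \<Longrightarrow> i < dA \<Longrightarrow> 0 < W1 t i" "\<And>t. t < k \<Longrightarrow> (\<Sum>i<dA. W1 t i) \<le> 1"
    and le: "(\<Sum>i<dA. pbar i * (\<Sum>t<k. w1 t i * - log 2 (W1 t i))) \<le> h"
    using good_measurement[OF dA compl cq pbar h[OF pbar]] by blast
  define w where "w t x = tensor_pow k dA w1 n (t mod k ^ n) (x mod dA ^ n)" for t x
  obtain \<phi> C where K: "kraus_system a b (dE ^ n) (k ^ n) (bob_output dA dB N n \<kappa>) (eve_output dA dE Nc n \<kappa>) \<phi> C U w"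
    using kraus_system_code[OF K1, of \<kappa> n] unfolding a_def b_def U_def w_def[abs_def] by blast
  note w0 = kraus_system_nonneg[OF K]
  have w_sum: "(\<Sum>t<k ^ n. w t x) = 1" if "x < a" for x using K that by (simp add: kraus_system_def)
  \<comment> \<open>Eve's outcome says nothing about the auxiliary qubits, so the guess for them is
    uniform; this adds \<open>\<kappa>\<close> bits to the loss.\<close>
  define W where "W t x = tensor_pow k dA W1 n t (x mod dA ^ n) / 2 ^ \<kappa>" for t x
  have Wpos: "0 < W t x" if "t < k ^ n" for t x
    unfolding W_def using tensor_pow_pos[OF W1(1) that mod] by simp
  have Wsum: "(\<Sum>x<a. W t x) \<le> 1" if t: "t < k ^ n" for t
  proof -
    have "(\<Sum>x<a. W t x) = (\<Sum>y<(2::nat) ^ \<kappa>. 1 / 2 ^ \<kappa>) * (\<Sum>i<dA ^ n. tensor_pow k dA W1 n t i)"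
      unfolding a_def W_def
      using sum_div_mod[where f = "\<lambda>_. 1 / 2 ^ \<kappa>" and g = "tensor_pow k dA W1 n t"
        and k = "2 ^ \<kappa>" and l = "dA ^ n"] by simp
    also have "\<dots> = (\<Sum>i<dA ^ n. tensor_pow k dA W1 n t i)" by simp
    also have "\<dots> \<le> 1" using tensor_pow_sum_le_one[OF W1 t] .
    finally show ?thesis .
  qed
  have Wle: "W t x \<le> 1" if "t < k ^ n" "x < a" for t x
  proof -
    have "W t x \<le> (\<Sum>x<a. W t x)"
      using that Wpos by (intro member_le_sum) (auto intro: less_imp_le)
    then show ?thesis using Wsum[OF that(1)] by linarith
  qed
  define S where "S t = {x. x < a \<and> 2 powr - A \<le> W t x}" for t
  have Ssub: "S t \<subseteq> {..<a}" for t by (auto simp: S_def)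
  \<comment> \<open>Each element of \<open>S t\<close> carries at least \<open>2 powr - A\<close> of
    a total mass of at most 1.\<close>
  have Scard: "real (card (S t)) \<le> 2 powr A" if t: "t < k ^ n" for t
  proof -
    have "real (card (S t)) * 2 powr - A = (\<Sum>x\<in>S t. 2 powr - A)" by simp
    also have "\<dots> \<le> (\<Sum>x\<in>S t. W t x)" by (rule sum_mono) (simp add: S_def)
    also have "\<dots> \<le> (\<Sum>x<a. W t x)"
      using Ssub Wpos[OF t] by (intro sum_mono2) (auto intro: less_imp_le)
    also have "\<dots> \<le> 1" by (rule Wsum[OF t])
    finally show ?thesis by (simp add: powr_minus field_simps)
  qed
  have lin_bob: "bob_output dA dB N n \<kappa> X $$ (r, r') =
      (\<Sum>p<a. \<Sum>q<a. X $$ (p, q) * bob_output dA dB N n \<kappa> (matrix_unit a p q) $$ (r, r'))"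
    if "r < b" "r' < b" for X r r'
    using that unfolding bob_output_def a_def b_def by (rule map_tensor_expand)
  have lin_eve: "eve_output dA dE Nc n \<kappa> X $$ (x, y) =
      (\<Sum>p<a. \<Sum>q<a. X $$ (p, q) * eve_output dA dE Nc n \<kappa> (matrix_unit a p q) $$ (x, y))"
    if "x < dE ^ n" "y < dE ^ n" for X x y
    using that unfolding eve_output_def a_def by (intro map_tensor_expand) simp_all
  define succ where "succ = (\<Sum>m<M. \<Sum>t<k ^ n. \<Sum>s<a. \<Sum>l<b.
      (cmod (\<Sum>x<a. c m s x * (\<Sum>r<b. C t r x * cnj (d m l r))))\<^sup>2)"
  have succ: "real M * (1 - \<epsilon>) \<le> succ"
  proof -
    have "Re (mtrace (bob_output dA dB N n \<kappa> (\<sigma> m) * (1\<^sub>m b - D m))) =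
      1 - (\<Sum>t<k ^ n. \<Sum>s<a. \<Sum>l<b. (cmod (\<Sum>x<a. c m s x * (\<Sum>r<b. C t r x * cnj (d m l r))))\<^sup>2)"
      if m: "m < M" for m
    proof -
      have bob: "bob_output dA dB N n \<kappa> (\<sigma> m) \<in> carrier_mat b b"
        by (simp add: bob_output_def map_tensor_def b_def)
      have Dm: "D m \<in> carrier_mat b b" using povm m by (auto simp: povm_def psd_def)
      have "(\<Sum>r<b. bob_output dA dB N n \<kappa> (\<sigma> m) $$ (r, r)) = (\<Sum>p<a. \<sigma> m $$ (p, p))"
        by (rule kraus_system_output_trace[OF K lin_bob R[OF m]])
      also have "\<dots> = mtrace (\<sigma> m)"
        using dens[OF m] by (auto simp: mtrace_def density_operator_def psd_def)
      also have "\<dots> = 1" using dens[OF m] by (simp add: density_operator_def)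
      finally have tr: "(\<Sum>r<b. bob_output dA dB N n \<kappa> (\<sigma> m) $$ (r, r)) = 1" .
      have "(\<Sum>r<b. \<Sum>r'<b. bob_output dA dB N n \<kappa> (\<sigma> m) $$ (r, r') * D m $$ (r', r)) = complex_of_real
        (\<Sum>t<k ^ n. \<Sum>s<a. \<Sum>l<b. (cmod (\<Sum>x<a. c m s x * (\<Sum>r<b. C t r x * cnj (d m l r))))\<^sup>2)"
        unfolding c_def by (rule kraus_system_measured_output[OF K lin_bob R[OF m] d[OF m]])
      then show ?thesis unfolding mtrace_mult_one_minus[OF bob Dm] tr by simp
    qed
    then have "(\<Sum>m<M. Re (mtrace (bob_output dA dB N n \<kappa> (\<sigma> m) * (1\<^sub>m b - D m)))) = real M - succ"
      by (simp add: succ_def sum_subtractf)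
    then show ?thesis using err M by (simp add: field_simps)
  qed
  obtain \<Omega> where \<Omega>: "prob_vector (k ^ n) \<Omega>"
    and lock: "(\<Sum>m<M. \<Sum>t<k ^ n. \<bar>(\<Sum>x<a. P m x * w t x) - \<Omega> t\<bar>) \<le> real M * \<delta>"
  proof -
    \<comment> \<open>Locking is invoked for a single POVM, the rank-one measurement that belongs to
      \<open>K\<close>.\<close>
    let ?Q = "\<lambda>t. outer (vec (dE ^ n) (\<phi> t)) (vec (dE ^ n) (\<phi> t))"
    have "povm (dE ^ n) (k ^ n) ?Q"
      using K by (intro rank_one_povm) (simp add: kraus_system_def)
    then obtain \<Omega> where \<Omega>: "prob_vector (k ^ n) \<Omega>"
      and le: "1 / real M * (\<Sum>m<M. \<Sum>t<k ^ n.
          cmod (mtrace (eve_output dA dE Nc n \<kappa> (\<sigma> m) * ?Q t) - of_real (\<Omega> t))) \<le> \<delta>"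
      using locked unfolding weakly_locked_def by blast
    have "cmod (mtrace (eve_output dA dE Nc n \<kappa> (\<sigma> m) * ?Q t) - of_real (\<Omega> t)) = \<bar>(\<Sum>x<a. P m x * w t x) - \<Omega> t\<bar>"
      if m: "m < M" and t: "t < k ^ n" for m t
    proof -
      have eve: "eve_output dA dE Nc n \<kappa> (\<sigma> m) \<in> carrier_mat (dE ^ n) (dE ^ n)"
        by (simp add: eve_output_def map_tensor_def)
      have "mtrace (eve_output dA dE Nc n \<kappa> (\<sigma> m) * ?Q t) = of_real (\<Sum>x<a. P m x * w t x)"
        unfolding mtrace_mult_outer[OF eve] P_def c_def
        by (rule kraus_system_eve[OF K lin_eve R[OF m] t])
      then show ?thesis by (simp only: of_real_diff[symmetric] norm_of_real)
    qed
    then have "(\<Sum>m<M. \<Sum>t<k ^ n. \<bar>(\<Sum>x<a. P m x * w t x) - \<Omega> t\<bar>) \<le> real M * \<delta>"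
      using le M by (simp add: field_simps)
    then show ?thesis using that \<Omega> by blast
  qed
  have tail: "(\<Sum>m<M. \<Sum>t<k ^ n. \<Sum>x\<in>{..<a} - S t. P m x * w t x) \<le> real M * ((real \<kappa> + real n * h) / A)"
  proof -
    let ?h = "\<lambda>i. \<Sum>t<k. w1 t i * - log 2 (W1 t i)"
    have log: "(\<Sum>t<k ^ n. w t x * - log 2 (W t x)) = real \<kappa> + (\<Sum>j<dA. ?h j * freq j x)" if x: "x < a" for x
    proof -
      have "(\<Sum>t<k ^ n. w t x * - log 2 (W t x)) = (\<Sum>t<k ^ n. w t x * real \<kappa> +
          tensor_pow k dA w1 n t (x mod dA ^ n) * - log 2 (tensor_pow k dA W1 n t (x mod dA ^ n)))"
      proof (rule sum.cong[OF refl])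
        fix t assume t: "t \<in> {..<k ^ n}"
        have "0 < tensor_pow k dA W1 n t (x mod dA ^ n)"
          using tensor_pow_pos[OF W1(1) _ mod] t by simp
        then have log: "log 2 (W t x) = log 2 (tensor_pow k dA W1 n t (x mod dA ^ n)) - real \<kappa>"
          by (simp add: W_def log_divide)
        show "w t x * - log 2 (W t x) = w t x * real \<kappa> +
          tensor_pow k dA w1 n t (x mod dA ^ n) * - log 2 (tensor_pow k dA W1 n t (x mod dA ^ n))"
          unfolding log using t by (simp add: w_def algebra_simps)
      qed
      also have "\<dots> = (\<Sum>t<k ^ n. w t x) * real \<kappa> + letter_sum dA ?h n (x mod dA ^ n)"
        unfolding sum.distrib sum_distrib_right
        using K1 W1(1) mod by (intro arg_cong2[where f = "(+)"] refl tensor_pow_expected_log)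
          (auto simp: kraus_system_def)
      also have "letter_sum dA ?h n (x mod dA ^ n) = (\<Sum>j<dA. ?h j * freq j x)"
        unfolding freq_def by (rule letter_sum_indicator[OF mod])
      finally show ?thesis using w_sum[OF x] by simp
    qed
    \<comment> \<open>Markov's inequality: \<open>- log 2 (W t x) / A\<close> is at least 1 outside
      \<open>S t\<close> and nonnegative for every input.\<close>
    have "(\<Sum>m<M. \<Sum>t<k ^ n. \<Sum>x\<in>{..<a} - S t. P m x * w t x)
        \<le> (\<Sum>m<M. \<Sum>t<k ^ n. \<Sum>x<a. P m x * w t x * (- log 2 (W t x) / A))"
    proof (intro sum_mono)
      fix m t assume "t \<in> {..<k ^ n}"
      then have t: "t < k ^ n" by simp
      have nn: "0 \<le> P m x * w t x * (- log 2 (W t x) / A)" if "x < a" for x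
        using P0 w0[OF t that] Wpos[OF t] Wle[OF t that] A
        by (intro mult_nonneg_nonneg divide_nonneg_pos) auto
      have "(\<Sum>x\<in>{..<a} - S t. P m x * w t x) \<le> (\<Sum>x\<in>{..<a} - S t. P m x * w t x * (- log 2 (W t x) / A))"
      proof (rule sum_mono)
        fix x assume "x \<in> {..<a} - S t"
        then have x: "x < a" "W t x < 2 powr - A" by (auto simp: S_def)
        have "log 2 (W t x) < - A"
          using x(2) Wpos[OF t, of x] by (simp add: log_less_iff)
        then have "1 \<le> - log 2 (W t x) / A" using A by (simp add: field_simps)
        then show "P m x * w t x \<le> P m x * w t x * (- log 2 (W t x) / A)"
          using mult_left_mono[of 1 "- log 2 (W t x) / A" "P m x * w t x"] P0 w0[OF t x(1)] by simp
      qed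
      also have "\<dots> \<le> (\<Sum>x<a. P m x * w t x * (- log 2 (W t x) / A))"
        using nn by (intro sum_mono2) auto
      finally show "(\<Sum>x\<in>{..<a} - S t. P m x * w t x) \<le> (\<Sum>x<a. P m x * w t x * (- log 2 (W t x) / A))" .
    qed
    also have "\<dots> = (\<Sum>m<M. \<Sum>x<a. P m x * (\<Sum>t<k ^ n. w t x * - log 2 (W t x))) / A"
      unfolding sum_divide_distrib sum_distrib_left
      by (rule sum.cong[OF refl], rule trans[OF sum.swap]) (simp add: mult.assoc)
    also have "(\<Sum>m<M. \<Sum>x<a. P m x * (\<Sum>t<k ^ n. w t x * - log 2 (W t x)))
        = (\<Sum>m<M. \<Sum>x<a. P m x * real \<kappa> + (\<Sum>j<dA. ?h j * (P m x * freq j x)))"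
      by (intro sum.cong refl) (simp only: log lessThan_iff distrib_left sum_distrib_left mult.left_commute)
    also have "\<dots> = (\<Sum>m<M. (\<Sum>x<a. P m x) * real \<kappa>) + (\<Sum>m<M. \<Sum>x<a. \<Sum>j<dA. ?h j * (P m x * freq j x))"
      by (simp only: sum.distrib sum_distrib_right)
    also have "(\<Sum>m<M. \<Sum>x<a. \<Sum>j<dA. ?h j * (P m x * freq j x)) = (\<Sum>j<dA. \<Sum>m<M. \<Sum>x<a. ?h j * (P m x * freq j x))"
      by (rule sum_swap3)
    also have "\<dots> = (\<Sum>j<dA. ?h j * (\<Sum>m<M. \<Sum>x<a. P m x * freq j x))"
      unfolding sum_distrib_left[symmetric] ..
    \<comment> \<open>Letter counts averaged over messages and positions are \<open>pbar\<close>, so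
      the bound \<open>le\<close> for the adapted measurement applies.\<close>
    also have "\<dots> = (\<Sum>j<dA. real M * real n * (pbar j * ?h j))"
      using n M by (intro sum.cong refl) (simp add: pbar_def)
    also have "(\<Sum>m<M. (\<Sum>x<a. P m x) * real \<kappa>) = real M * real \<kappa>" by (simp add: P1)
    also have "(\<Sum>j<dA. real M * real n * (pbar j * ?h j)) \<le> real M * real n * h"
      unfolding sum_distrib_left[symmetric] using le by (intro mult_left_mono) auto
    finally show ?thesis using A by (simp add: divide_right_mono algebra_simps)
  qed
  have orth: "(\<Sum>y<b. C t y x * cnj (C t y x')) = (if x = x' then of_real (w t x) else 0)"
    if "t < k ^ n" "x < a" "x' < a" for t x x'
    using K that by (simp add: kraus_system_def)
  have resD: "(\<Sum>m<M. \<Sum>l<b. d m l y * cnj (d m l y')) = (if y = y' then 1 else 0)"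
    if y: "y < b" "y' < b" for y y'
  proof -
    have "(\<Sum>m<M. \<Sum>l<b. d m l y * cnj (d m l y')) = mat b b (\<lambda>rc. \<Sum>m<M. D m $$ rc) $$ (y, y')"
      using y by (simp add: d)
    also have "\<dots> = (if y = y' then 1 else 0)" using povm y by (simp add: povm_def)
    finally show ?thesis .
  qed
  have "sqrt (real M * (1 - \<epsilon>)) \<le> sqrt succ" using succ by (rule real_sqrt_le_mono)
  also have "\<dots> \<le> sqrt (2 powr A + real M * \<delta>) + sqrt (\<Sum>m<M. \<Sum>t<k ^ n. \<Sum>x\<in>{..<a} - S t. P m x * w t x)"
    unfolding succ_def P_def
    using orth resD lock[unfolded P_def] \<Omega> Ssub Scard
    by (intro one_shot_converse[where b = "\<lambda>t x y. C t y x" and \<Omega> = \<Omega>]) (auto simp: prob_vector_def)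
  \<comment> \<open>Factoring out \<open>sqrt (real M)\<close> turns sums over messages into
    averages.\<close>
  also have "\<dots> \<le> sqrt (real M * (2 powr A / real M + \<delta>)) + sqrt (real M * ((real \<kappa> + real n * h) / A))"
    using tail M by (intro add_mono real_sqrt_le_mono) (simp_all add: distrib_left)
  finally have "sqrt (real M) * sqrt (1 - \<epsilon>) \<le>
      sqrt (real M) * (sqrt (2 powr A / real M + \<delta>) + sqrt ((real \<kappa> + real n * h) / A))"
    by (simp only: real_sqrt_mult distrib_left[of "sqrt (real M)"])
  then show ?thesis using M by simp
qed

section \<open>The limit of large block lengths\<close>

theorem proposition3:
  fixes dA dB dE :: nat
    and N Nc :: "complex mat \<Rightarrow> complex mat"
    and e :: "nat \<Rightarrow> complex vec" and \<rho> :: "nat \<Rightarrow> complex mat"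
  assumes "0 < dA"
    and "quantum_channel dA dB N"
    and "complementary_channel dA dB dE N Nc"
    and "cq_channel dA dE Nc e \<rho>"
  shows "weak_locking_capacity dA dB dE N Nc
    \<le> (SUP p \<in> {p. prob_vector dA p}. acc_cond_entropy dA dE p \<rho>)"
  unfolding weak_locking_capacity_def
proof (rule SUP_least, rule ccontr)
  note dA = assms(1) and compl = assms(3) and cq = assms(4)
  fix R assume "R \<in> {R. achievable_rate dA dB dE N Nc R}"
  then obtain \<kappa> \<epsilon> \<delta> M \<sigma> D where \<kappa>: "(\<lambda>n. real (\<kappa> n)) \<in> o(\<lambda>n. real n)"
    and \<epsilon>: "\<epsilon> \<longlonglongrightarrow> 0" and \<delta>: "\<delta> \<longlonglongrightarrow> 0"
    and codes: "\<forall>\<^sub>F n in sequentially.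
           is_code dA dB N n (\<kappa> n) (\<epsilon> n) (M n) (\<sigma> n) (D n) \<and>
           weakly_locked dA dE Nc n (\<kappa> n) (\<delta> n) (M n) (\<sigma> n) \<and>
           2 powr (real n * R) \<le> real (M n)"
    unfolding achievable_rate_def by blast
  assume "\<not> ereal R \<le> (SUP p\<in>{p. prob_vector dA p}. acc_cond_entropy dA dE p \<rho>)"
  then obtain h where h: "(SUP p\<in>{p. prob_vector dA p}. acc_cond_entropy dA dE p \<rho>) < ereal h" and "ereal h < ereal R"
    using ereal_dense2 by (metis not_le)
  \<comment> \<open>The gap \<open>r < R\<close> makes the dimension term vanish, and
    \<open>h < r\<close> keeps the Markov term below 1.\<close>
  then obtain r where r: "h < r" "r < R" using dense by auto
  have acc: "acc_cond_entropy dA dE p \<rho> < ereal h" if "prob_vector dA p" for p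
    by (rule le_less_trans[OF SUP_upper h]) (simp add: that)
  have h0: "0 \<le> h" using entropy_bound_nonneg[OF dA compl cq acc] .
  then have r0: "0 < r" using r by simp
  \<comment> \<open>The ratio of \<open>2 powr (n r)\<close> likely inputs to
    \<open>2 powr (n R)\<close> messages is \<open>q ^ n\<close>.\<close>
  define q where "q = 2 powr (r - R)"
  have q: "0 < q" "q < 1" using r by (simp_all add: q_def powr_less_one)
  have "\<forall>\<^sub>F n in sequentially. sqrt (1 - \<epsilon> n) \<le> sqrt (q ^ n + \<delta> n) + sqrt ((real (\<kappa> n) / real n + h) / r)"
    using codes eventually_gt_at_top[of 0]
  proof eventually_elim
    case (elim n)
    then have n: "0 < n" and M: "2 powr (real n * R) \<le> real (M n)" by auto
    have "sqrt (1 - \<epsilon> n) \<le> sqrt (2 powr (real n * r) / real (M n) + \<delta> n)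
        + sqrt ((real (\<kappa> n) + real n * h) / (real n * r))"
      using elim n r0 by (intro code_bound[OF dA compl cq _ _ acc]) auto
    also have "(real (\<kappa> n) + real n * h) / (real n * r) = (real (\<kappa> n) / real n + h) / r"
      using n r0 by (simp add: field_simps)
    finally have le: "sqrt (1 - \<epsilon> n) \<le> sqrt (2 powr (real n * r) / real (M n) + \<delta> n)
        + sqrt ((real (\<kappa> n) / real n + h) / r)" .
    have "2 powr (real n * r) / real (M n) \<le> 2 powr (real n * r) / 2 powr (real n * R)"
      using M less_le_trans[OF _ M, of 0] by (intro divide_left_mono mult_pos_pos) auto
    also have "\<dots> = 2 powr ((r - R) * real n)"
      by (simp add: powr_diff[symmetric] algebra_simps)
    also have "\<dots> = q ^ n"
      unfolding q_def powr_powr[symmetric] by (rule powr_realpow) simp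
    finally have "sqrt (2 powr (real n * r) / real (M n) + \<delta> n) \<le> sqrt (q ^ n + \<delta> n)" by simp
    with le show ?case by linarith
  qed
  moreover have "(\<lambda>n. sqrt (1 - \<epsilon> n)) \<longlonglongrightarrow> sqrt (1 - 0)"
    by (intro tendsto_intros \<epsilon>)
  \<comment> \<open>Here \<open>q ^ n\<close>, \<open>\<delta> n\<close> and
    \<open>\<kappa> n / n\<close> tend to 0, the last because the number of auxiliary qubits is
    sublinear.\<close>
  moreover have "(\<lambda>n. sqrt (q ^ n + \<delta> n) + sqrt ((real (\<kappa> n) / real n + h) / r))
      \<longlonglongrightarrow> sqrt (0 + 0) + sqrt ((0 + h) / r)"
    using q r0 by (intro tendsto_intros \<delta> LIMSEQ_realpow_zero smalloD_tendsto[OF \<kappa>]) auto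
  ultimately have "sqrt (1 - 0) \<le> sqrt (0 + 0) + sqrt ((0 + h) / r)"
    by (intro tendsto_le[OF sequentially_bot])
  then have "1 \<le> h / r" by simp
  then show False using r r0 by simp
qed

end
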